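(* Given a free-cofree presentation $\varphi\colon F_0\to E_0$ of an $n$-graded module $M$, a generator-minimal free-cofree presentation of $M$ can be constructed using the relative Schreyer's presentation $\partial_1\colon F_1\to F_0$ and $n$-graded pruning.
   Context: $\Bbbk$ is a field, $R=\Bbbk[X_1,\dots,X_n]$ with standard $\mathbb Z^n$-grading, $\mathfrak m=(X_1,\dots,X_n)$, $(\Sigma^\beta M)_\alpha=M_{\alpha-\beta}$, and $E(\Bbbk)=\Bbbk[X_1^{-1},\dots,X_n^{-1}]$ is the graded injective hull of $\Bbbk$. Presented modules are graded, finitely generated and finitely supported (only finitely many non-zero graded components), and, after a shift, supported in $\mathbb N^n$. A free-cofree presentation of $M$ is a graded homomorphism $\varphi\colon F_0=\bigoplus_{j=1}^t\Sigma^{\beta_j}R\to E_0=\bigoplus_{i=1}^s\Sigma^{\alpha_i}E(\Bbbk)$ with $\operatorname{im}\varphi\cong M$. It is generator-minimal if $\ker\varphi\subseteq\mathfrak mF_0$. It is given by a matrix $A=(a_{ij})\in\Bbbk^{s\times t}$ with $a_{ij}=0$ unless $\beta_j\le\alpha_i$. Let $G_E=\{X_k^{\alpha_{ik}+1}\mathbf e_i\mid 1\le i\le s,\,1\le k\le n\}\subseteq R^s$, $U=\langle G_E\rangle$, $\mathbf h_j=X^{\beta_j}\sum_i a_{ij}\mathbf e_i$, $H=\{\mathbf h_1,\dots,\mathbf h_t\}$ and $V=\langle H\rangle+U$. Then $\operatorname{im}\varphi$ is identified with $V/U\subseteq R^s/U$. Fix a position-over-term monomial order on $R^s$; $\mathrm{lm}$,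 $\mathrm{lt}$ denote leading monomial and leading term, and $\mathrm{lm}(W)$ the span of the leading monomials of non-zero elements of a submodule $W$. The presentation is in Gröbner form if $H$ is a Gröbner basis of $V$ relative to $U$: $H\subseteq V\setminus U$, its elements are supported outside $\mathrm{lm}(U)$, and $\langle\mathrm{lm}(H)\rangle+\mathrm{lm}(U)=\mathrm{lm}(V)$. A presentation not in this form is first brought into it by a relative version of Buchberger's algorithm, which appends columns to $A$ without changing the image; $F_0$ then denotes the new source. Relative Schreyer's presentation (for Gröbner form): put $\mathbf g_j=\mathbf h_j$ for $j\le t$ and list $G_E$ as $\mathbf g_{t+1},\dots,\mathbf g_q$. For $i<j$ with $i\le t$ and the leading monomials of $\mathbf g_i,\mathbf g_j$ in the same component, let $\mathbf m_{ij}$ be their least common multiple and write $\frac{\mathbf m_{ij}}{\mathrm{lt}(\mathbf g_i)}\mathbf g_i-\frac{\mathbf m_{ij}}{\mathrm{lt}(\mathbf g_j)}\mathbf g_j=\sum_k a_{ijk}\mathbf g_k$ by polynomial division (cancelling leading terms by $G_E$ where possible, otherwise by $H$). The columns of $\partial_1$ are the projections to the first $t$ coordinates of $\frac{\mathbf m_{ij}}{\mathrm{lt}(\mathbf g_i)}\mathbf e_i-\frac{\mathbf m_{ij}}{\mathrm{lt}(\mathbf g_j)}\mathbf e_j-\sum_k a_{ijk}\mathbf e_k$. Pruning of $\partial_1$ is the procedure eliminating redundant generators, which correspond to rows of $\partial_1$: repeatedly choose a non-zero constant entry, use its column to clear the other entries of its row by column operations, and delete that row and column, until no non-zero constant entry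 is left. *)

theory Defs
  imports Complex_Main "HOL-Library.Poly_Mapping" "HOL-Library.Function_Algebras"
begin

text \<open>
  The variables are indexed by a finite type \<open>'v\<close>, so \<open>n = CARD('v)\<close>; \<open>R\<close> is the
  monoid algebra of \<open>'v \<Rightarrow>\<^sub>0 nat\<close> over \<open>'k\<close>. Degrees are functions \<open>'v \<Rightarrow> int\<close> with the
  componentwise order. Elements of direct sums are functions on \<open>nat\<close> that vanish
  outside the index set: rows are indexed by \<open>{..<s}\<close>, columns by a finite set \<open>J\<close>
  of natural numbers, so that deleting a column does not renumber the others.
\<close>

type_synonym 'v mon = "'v \<Rightarrow>\<^sub>0 nat"
type_synonym ('v, 'k) mpoly = "'v mon \<Rightarrow>\<^sub>0 'k"
type_synonym ('v, 'k) vec = "nat \<Rightarrow> ('v, 'k) mpoly"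
type_synonym 'v deg = "'v \<Rightarrow> int"

definition cst :: "'k \<Rightarrow> ('v, 'k::field) mpoly" where
  "cst c = Poly_Mapping.single 0 c"

definition X :: "'v \<Rightarrow> ('v, 'k::field) mpoly" where
  "X k = Poly_Mapping.single (Poly_Mapping.single k 1) 1"

definition deg_of :: "'v mon \<Rightarrow> 'v deg" where
  "deg_of a = (\<lambda>k. int (Poly_Mapping.lookup a k))"

text \<open>Negative exponents are truncated to \<open>0\<close>.\<close>

definition mon_of :: "'v::finite deg \<Rightarrow> 'v mon" where
  "mon_of \<gamma> = Poly_Mapping.Abs_poly_mapping (\<lambda>k. nat (\<gamma> k))"

definition lcm_mon :: "'v::finite mon \<Rightarrow> 'v mon \<Rightarrow> 'v mon" where
  "lcm_mon a b = Poly_Mapping.Abs_poly_mapping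
     (\<lambda>k. max (Poly_Mapping.lookup a k) (Poly_Mapping.lookup b k))"

definition mon_dvd :: "'v mon \<Rightarrow> 'v mon \<Rightarrow> bool" where
  "mon_dvd a b \<longleftrightarrow> (\<exists>c. b = a + c)"

definition max_ideal :: "('v, 'k::field) mpoly set" where
  "max_ideal = module.span (*) (range X)"


section \<open>Graded modules\<close>

text \<open>The carrier \<open>M\<close> is a submodule of an \<open>R\<close>-module type; \<open>Mg \<gamma>\<close> is the component of
  degree \<open>\<gamma>\<close>.\<close>

definition graded_module ::
  "(('v, 'k::field) mpoly \<Rightarrow> 'm \<Rightarrow> 'm::ab_group_add) \<Rightarrow> 'm set \<Rightarrow> ('v deg \<Rightarrow> 'm set) \<Rightarrow> bool" where
  "graded_module sc M Mg \<longleftrightarrow>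
     module sc \<and> module.subspace sc M \<and>
     (\<forall>\<gamma>. Mg \<gamma> \<subseteq> M \<and> 0 \<in> Mg \<gamma> \<and> (\<forall>x\<in>Mg \<gamma>. \<forall>y\<in>Mg \<gamma>. x + y \<in> Mg \<gamma>)) \<and>
     (\<forall>\<gamma> a c. \<forall>x\<in>Mg \<gamma>. sc (Poly_Mapping.single a c) x \<in> Mg (\<gamma> + deg_of a)) \<and>
     (\<forall>x\<in>M. \<exists>!u. (\<forall>\<gamma>. u \<gamma> \<in> Mg \<gamma>) \<and> finite {\<gamma>. u \<gamma> \<noteq> 0} \<and> x = (\<Sum>\<gamma>\<in>{\<gamma>. u \<gamma> \<noteq> 0}. u \<gamma>))"

definition fin_gen :: "(('v, 'k::field) mpoly \<Rightarrow> 'm \<Rightarrow> 'm::ab_group_add) \<Rightarrow> 'm set \<Rightarrow> bool" where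
  "fin_gen sc M \<longleftrightarrow> (\<exists>S. finite S \<and> M = module.span sc S)"

definition graded_support :: "('v deg \<Rightarrow> 'm::zero set) \<Rightarrow> 'v deg set" where
  "graded_support Mg = {\<gamma>. Mg \<gamma> \<noteq> {0}}"

definition graded_isomorphic ::
  "(('v, 'k::field) mpoly \<Rightarrow> 'm \<Rightarrow> 'm::ab_group_add) \<Rightarrow> 'm set \<Rightarrow> ('v deg \<Rightarrow> 'm set) \<Rightarrow>
   (('v, 'k) mpoly \<Rightarrow> 'l \<Rightarrow> 'l::ab_group_add) \<Rightarrow> 'l set \<Rightarrow> ('v deg \<Rightarrow> 'l set) \<Rightarrow> bool" where
  "graded_isomorphic sc M Mg sc' N Ng \<longleftrightarrow>
     (\<exists>\<psi>. bij_betw \<psi> M N \<and>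
        (\<forall>x\<in>M. \<forall>y\<in>M. \<psi> (x + y) = \<psi> x + \<psi> y) \<and>
        (\<forall>p. \<forall>x\<in>M. \<psi> (sc p x) = sc' p (\<psi> x)) \<and>
        (\<forall>\<gamma>. \<psi> ` Mg \<gamma> = Ng \<gamma>))"


section \<open>Free-cofree presentations\<close>

definition pscale :: "('v, 'k::field) mpoly \<Rightarrow> ('v, 'k) vec \<Rightarrow> ('v, 'k) vec" where
  "pscale p v = (\<lambda>i. p * v i)"

lemma module_pscale: "module pscale"
  by standard (auto simp: pscale_def fun_eq_iff algebra_simps)

text \<open>The \<open>R\<close>-module \<open>F\<^sub>0\<close>; the \<open>j\<close>-th basis element has degree \<open>\<beta> j\<close>.\<close>

definition free_mod :: "nat set \<Rightarrow> ('v, 'k::field) vec set" where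
  "free_mod J = {f. \<forall>j. j \<notin> J \<longrightarrow> f j = 0}"

text \<open>An element \<open>e\<close> of \<open>E(k) = k[X\<^sub>1\<^sup>-\<^sup>1, \<dots>, X\<^sub>n\<^sup>-\<^sup>1]\<close> is stored as a polynomial in the inverse
  variables: the key \<open>a\<close> stands for \<open>X\<^sup>-\<^sup>a\<close>, of degree \<open>- deg_of a\<close>. Here
  \<open>X\<^sup>b \<cdot> X\<^sup>-\<^sup>a\<close> is \<open>X\<^sup>-\<^sup>(\<^sup>a\<^sup>-\<^sup>b\<^sup>)\<close> if \<open>b\<close> divides \<open>a\<close>, and \<open>0\<close> otherwise.\<close>

definition contr :: "('v, 'k::field) mpoly \<Rightarrow> ('v, 'k) mpoly \<Rightarrow> ('v, 'k) mpoly" where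
  "contr p e = (\<Sum>b\<in>Poly_Mapping.keys p. \<Sum>a\<in>{a \<in> Poly_Mapping.keys e. mon_dvd b a}.
     Poly_Mapping.single (a - b) (Poly_Mapping.lookup p b * Poly_Mapping.lookup e a))"

definition escale :: "('v, 'k::field) mpoly \<Rightarrow> ('v, 'k) vec \<Rightarrow> ('v, 'k) vec" where
  "escale p u = (\<lambda>i. contr p (u i))"

text \<open>The component of degree \<open>\<gamma>\<close> of \<open>E\<^sub>0\<close>, the direct sum of the \<open>\<Sigma>\<^bsup>\<alpha> i\<^esup> E(k)\<close> for \<open>i < s\<close>.\<close>

definition cofree_comp :: "nat \<Rightarrow> (nat \<Rightarrow> 'v deg) \<Rightarrow> 'v deg \<Rightarrow> ('v, 'k::field) vec set" where
  "cofree_comp s \<alpha> \<gamma> = {u. (\<forall>i. s \<le> i \<longrightarrow> u i = 0) \<and>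
     (\<forall>i. \<forall>a\<in>Poly_Mapping.keys (u i). \<alpha> i - deg_of a = \<gamma>)}"

definition fc_matrix ::
  "nat \<Rightarrow> (nat \<Rightarrow> 'v deg) \<Rightarrow> nat set \<Rightarrow> (nat \<Rightarrow> 'v deg) \<Rightarrow> (nat \<Rightarrow> nat \<Rightarrow> 'k::field) \<Rightarrow> bool" where
  "fc_matrix s \<alpha> J \<beta> A \<longleftrightarrow> finite J \<and> (\<forall>i<s. \<forall>j\<in>J. \<not> \<beta> j \<le> \<alpha> i \<longrightarrow> A i j = 0)"

text \<open>\<open>\<phi>\<close> sends the \<open>j\<close>-th basis element to the element of degree \<open>\<beta> j\<close> of \<open>E\<^sub>0\<close> with
  coefficients \<open>A i j\<close>. In \<open>\<Sigma>\<^bsup>\<alpha> i\<^esup> E(k)\<close> the degree \<open>\<beta> j\<close> belongs to the monomial with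
  exponent \<open>- (\<alpha> i - \<beta> j)\<close>; where the difference is not in \<open>\<nat>\<^sup>n\<close>, \<open>fc_matrix\<close> makes
  \<open>A i j\<close> zero.\<close>

definition phi ::
  "nat \<Rightarrow> (nat \<Rightarrow> 'v::finite deg) \<Rightarrow> nat set \<Rightarrow> (nat \<Rightarrow> 'v deg) \<Rightarrow> (nat \<Rightarrow> nat \<Rightarrow> 'k::field) \<Rightarrow>
   ('v, 'k) vec \<Rightarrow> ('v, 'k) vec" where
  "phi s \<alpha> J \<beta> A f = (\<Sum>j\<in>J. escale (f j)
     (\<lambda>i. if i < s then Poly_Mapping.single (mon_of (\<alpha> i - \<beta> j)) (A i j) else 0))"

definition phi_image ::
  "nat \<Rightarrow> (nat \<Rightarrow> 'v::finite deg) \<Rightarrow> nat set \<Rightarrow> (nat \<Rightarrow> 'v deg) \<Rightarrow> (nat \<Rightarrow> nat \<Rightarrow> 'k::field) \<Rightarrow>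
   ('v, 'k) vec set" where
  "phi_image s \<alpha> J \<beta> A = phi s \<alpha> J \<beta> A ` free_mod J"

definition fc_presentation ::
  "nat \<Rightarrow> (nat \<Rightarrow> 'v::finite deg) \<Rightarrow> nat set \<Rightarrow> (nat \<Rightarrow> 'v deg) \<Rightarrow> (nat \<Rightarrow> nat \<Rightarrow> 'k::field) \<Rightarrow>
   (('v, 'k) mpoly \<Rightarrow> 'm \<Rightarrow> 'm::ab_group_add) \<Rightarrow> 'm set \<Rightarrow> ('v deg \<Rightarrow> 'm set) \<Rightarrow> bool" where
  "fc_presentation s \<alpha> J \<beta> A sc M Mg \<longleftrightarrow> fc_matrix s \<alpha> J \<beta> A \<and>
     graded_isomorphic escale (phi_image s \<alpha> J \<beta> A)
       (\<lambda>\<gamma>. phi_image s \<alpha> J \<beta> A \<inter> cofree_comp s \<alpha> \<gamma>) sc M Mg"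

definition generator_minimal ::
  "nat \<Rightarrow> (nat \<Rightarrow> 'v::finite deg) \<Rightarrow> nat set \<Rightarrow> (nat \<Rightarrow> 'v deg) \<Rightarrow> (nat \<Rightarrow> nat \<Rightarrow> 'k::field) \<Rightarrow> bool" where
  "generator_minimal s \<alpha> J \<beta> A \<longleftrightarrow>
     {f \<in> free_mod J. phi s \<alpha> J \<beta> A f = 0}
       \<subseteq> module.span pscale {pscale p f | p f. p \<in> max_ideal \<and> f \<in> free_mod J}"


section \<open>Monomial orders and leading terms in \<open>R\<^sup>s\<close>\<close>

text \<open>The pair \<open>(i, a)\<close> stands for the monomial \<open>X\<^sup>a e\<^sub>i\<close>. Either direction (indeed any
  linear order) is allowed for comparing positions.\<close>

definition term_order :: "('v mon \<Rightarrow> 'v mon \<Rightarrow> bool) \<Rightarrow> bool" where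
  "term_order lt \<longleftrightarrow> irreflp lt \<and> transp lt \<and> totalp lt \<and>
     (\<forall>a. a \<noteq> 0 \<longrightarrow> lt 0 a) \<and> (\<forall>a b c. lt a b \<longrightarrow> lt (a + c) (b + c))"

definition pot_order :: "nat \<Rightarrow> (nat \<times> 'v mon \<Rightarrow> nat \<times> 'v mon \<Rightarrow> bool) \<Rightarrow> bool" where
  "pot_order s ord \<longleftrightarrow> (\<exists>pos lt.
     irreflp_on {..<s} pos \<and> transp_on {..<s} pos \<and> totalp_on {..<s} pos \<and> term_order lt \<and>
     (\<forall>i<s. \<forall>j<s. \<forall>a b. ord (i, a) (j, b) \<longleftrightarrow> pos i j \<or> (i = j \<and> lt a b)))"

definition mvec :: "nat \<times> 'v mon \<Rightarrow> ('v, 'k::field) vec" where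
  "mvec m = (\<lambda>l. if l = fst m then Poly_Mapping.single (snd m) 1 else 0)"

definition supp :: "('v, 'k::field) vec \<Rightarrow> (nat \<times> 'v mon) set" where
  "supp v = {(i, a). a \<in> Poly_Mapping.keys (v i)}"

definition lm :: "(nat \<times> 'v mon \<Rightarrow> nat \<times> 'v mon \<Rightarrow> bool) \<Rightarrow> ('v, 'k::field) vec \<Rightarrow> nat \<times> 'v mon" where
  "lm ord v = (THE m. m \<in> supp v \<and> (\<forall>m'\<in>supp v. m' \<noteq> m \<longrightarrow> ord m' m))"

definition lc :: "(nat \<times> 'v mon \<Rightarrow> nat \<times> 'v mon \<Rightarrow> bool) \<Rightarrow> ('v, 'k::field) vec \<Rightarrow> 'k" where
  "lc ord v = Poly_Mapping.lookup (v (fst (lm ord v))) (snd (lm ord v))"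

definition lm_dvd ::
  "(nat \<times> 'v mon \<Rightarrow> nat \<times> 'v mon \<Rightarrow> bool) \<Rightarrow> ('v, 'k::field) vec \<Rightarrow> ('v, 'k) vec \<Rightarrow> bool" where
  "lm_dvd ord g r \<longleftrightarrow> fst (lm ord g) = fst (lm ord r) \<and> mon_dvd (snd (lm ord g)) (snd (lm ord r))"

text \<open>The \<open>k\<close>-linear span of the leading monomials of the non-zero elements.\<close>

definition lm_span ::
  "(nat \<times> 'v mon \<Rightarrow> nat \<times> 'v mon \<Rightarrow> bool) \<Rightarrow> ('v, 'k::field) vec set \<Rightarrow> ('v, 'k) vec set" where
  "lm_span ord W = module.span (\<lambda>c. pscale (cst c)) {mvec (lm ord w) | w. w \<in> W \<and> w \<noteq> 0}"


section \<open>Groebner form\<close>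

text \<open>In this and the following sections \<open>\<alpha>\<close> and \<open>\<beta>\<close> are the degrees after the shift that
  moves the module into \<open>\<nat>\<^sup>n\<close>. A row with \<open>\<alpha> i\<close> not in \<open>\<nat>\<^sup>n\<close> is then zero, and the
  truncation in \<open>gE\<close> gives the generator \<open>e\<^sub>i\<close> of \<open>U\<close> for some \<open>k\<close>.\<close>

definition gE :: "(nat \<Rightarrow> 'v deg) \<Rightarrow> nat \<Rightarrow> 'v \<Rightarrow> ('v, 'k::field) vec" where
  "gE \<alpha> i k = mvec (i, Poly_Mapping.single k (nat (\<alpha> i k + 1)))"

definition hcol ::
  "nat \<Rightarrow> (nat \<Rightarrow> 'v::finite deg) \<Rightarrow> (nat \<Rightarrow> nat \<Rightarrow> 'k::field) \<Rightarrow> nat \<Rightarrow> ('v, 'k) vec" where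
  "hcol s \<beta> A j = (\<lambda>i. if i < s then Poly_Mapping.single (mon_of (\<beta> j)) (A i j) else 0)"

definition Umod :: "nat \<Rightarrow> (nat \<Rightarrow> 'v deg) \<Rightarrow> ('v, 'k::field) vec set" where
  "Umod s \<alpha> = module.span pscale {gE \<alpha> i k | i k. i < s}"

definition Vmod ::
  "nat \<Rightarrow> (nat \<Rightarrow> 'v::finite deg) \<Rightarrow> nat set \<Rightarrow> (nat \<Rightarrow> 'v deg) \<Rightarrow> (nat \<Rightarrow> nat \<Rightarrow> 'k::field) \<Rightarrow>
   ('v, 'k) vec set" where
  "Vmod s \<alpha> J \<beta> A = {x + y | x y. x \<in> module.span pscale (hcol s \<beta> A ` J) \<and> y \<in> Umod s \<alpha>}"

definition groebner_form ::
  "(nat \<times> 'v::finite mon \<Rightarrow> nat \<times> 'v mon \<Rightarrow> bool) \<Rightarrow> nat \<Rightarrow> (nat \<Rightarrow> 'v deg) \<Rightarrow> nat set \<Rightarrow>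
   (nat \<Rightarrow> 'v deg) \<Rightarrow> (nat \<Rightarrow> nat \<Rightarrow> 'k::field) \<Rightarrow> bool" where
  "groebner_form ord s \<alpha> J \<beta> A \<longleftrightarrow>
     hcol s \<beta> A ` J \<subseteq> Vmod s \<alpha> J \<beta> A - Umod s \<alpha> \<and>
     (\<forall>j\<in>J. \<forall>m\<in>supp (hcol s \<beta> A j). mvec m \<notin> lm_span ord (Umod s \<alpha> :: ('v, 'k) vec set)) \<and>
     {x + y | x y. x \<in> module.span pscale ((\<lambda>h. mvec (lm ord h)) ` hcol s \<beta> A ` J) \<and>
                   y \<in> lm_span ord (Umod s \<alpha>)} = lm_span ord (Vmod s \<alpha> J \<beta> A)"

text \<open>What Buchberger's algorithm relative to \<open>U\<close> returns for a matrix with columns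
  \<open>{..<t}\<close> and (unshifted) degrees \<open>\<alpha>\<close>, \<open>\<beta>\<close>: a matrix in Groebner form obtained by
  appending columns without changing the image. Zero columns of the input are
  dropped, since they give \<open>h\<^sub>j = 0 \<in> U\<close>. \<open>\<delta>\<close> is the shift.\<close>

definition groebner_completion ::
  "(nat \<times> 'v::finite mon \<Rightarrow> nat \<times> 'v mon \<Rightarrow> bool) \<Rightarrow> 'v deg \<Rightarrow> nat \<Rightarrow> (nat \<Rightarrow> 'v deg) \<Rightarrow>
   nat \<Rightarrow> (nat \<Rightarrow> 'v deg) \<Rightarrow> (nat \<Rightarrow> nat \<Rightarrow> 'k::field) \<Rightarrow>
   nat set \<Rightarrow> (nat \<Rightarrow> 'v deg) \<Rightarrow> (nat \<Rightarrow> nat \<Rightarrow> 'k) \<Rightarrow> bool" where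
  "groebner_completion ord \<delta> s \<alpha> t \<beta> A J \<beta>' A' \<longleftrightarrow>
     (\<exists>t'\<ge>t. J = {j. j < t \<and> (\<exists>i<s. A i j \<noteq> 0)} \<union> {t..<t'}) \<and>
     (\<forall>j<t. \<beta>' j = \<beta> j \<and> (\<forall>i<s. A' i j = A i j)) \<and>
     fc_matrix s \<alpha> J \<beta>' A' \<and>
     phi_image s \<alpha> J \<beta>' A' = phi_image s \<alpha> {..<t} \<beta> A \<and>
     groebner_form ord s (\<lambda>i. \<alpha> i - \<delta>) J (\<lambda>j. \<beta>' j - \<delta>) A'"


section \<open>The relative Schreyer presentation\<close>

text \<open>The family \<open>g\<close> is indexed by a sum type: \<open>Inl j\<close> for \<open>h\<^sub>j\<close>, and \<open>Inr (i, k)\<close> for the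
  element \<open>X\<^sub>k\<^bsup>\<alpha> i k + 1\<^esup> e\<^sub>i\<close> of \<open>G\<^sub>E\<close>; all \<open>Inl\<close> precede all \<open>Inr\<close>.\<close>

type_synonym 'v gidx = "nat + nat \<times> 'v"

definition gen ::
  "nat \<Rightarrow> (nat \<Rightarrow> 'v::finite deg) \<Rightarrow> (nat \<Rightarrow> 'v deg) \<Rightarrow> (nat \<Rightarrow> nat \<Rightarrow> 'k::field) \<Rightarrow>
   'v gidx \<Rightarrow> ('v, 'k) vec" where
  "gen s \<alpha> \<beta> A = case_sum (hcol s \<beta> A) (\<lambda>(i, k). gE \<alpha> i k)"

text \<open>\<open>division ord s J g r a\<close>: some run of the division algorithm on \<open>r\<close> ends with
  remainder \<open>0\<close> and quotients \<open>a\<close>.\<close>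

inductive division ::
  "(nat \<times> 'v::finite mon \<Rightarrow> nat \<times> 'v mon \<Rightarrow> bool) \<Rightarrow> nat \<Rightarrow> nat set \<Rightarrow> ('v gidx \<Rightarrow> ('v, 'k::field) vec) \<Rightarrow>
   ('v, 'k) vec \<Rightarrow> ('v gidx \<Rightarrow> ('v, 'k) mpoly) \<Rightarrow> bool"
  for ord s J g where
  zero: "division ord s J g 0 (\<lambda>_. 0)"
| step: "division ord s J g r (a(k := a k + p))"
  if "r \<noteq> 0"
    and "k \<in> Inl ` J \<union> Inr ` ({..<s} \<times> UNIV)"
    and "lm_dvd ord (g k) r"
    and "k \<in> range Inl \<Longrightarrow> \<forall>l\<in>Inr ` ({..<s} \<times> UNIV). \<not> lm_dvd ord (g l) r"
    and "p = Poly_Mapping.single (snd (lm ord r) - snd (lm ord (g k))) (lc ord r / lc ord (g k))"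
    and "division ord s J g (r - pscale p (g k)) a"

definition spairs ::
  "(nat \<times> 'v::finite mon \<Rightarrow> nat \<times> 'v mon \<Rightarrow> bool) \<Rightarrow> nat \<Rightarrow> nat set \<Rightarrow> ('v gidx \<Rightarrow> ('v, 'k::field) vec) \<Rightarrow>
   (nat \<times> 'v gidx) set" where
  "spairs ord s J g = {(i, l). i \<in> J \<and>
     l \<in> Inl ` {j \<in> J. i < j} \<union> Inr ` ({..<s} \<times> UNIV) \<and>
     fst (lm ord (g (Inl i))) = fst (lm ord (g l))}"

text \<open>The term \<open>lcm(lm v, lm w) / lt(v)\<close>.\<close>

definition cofactor ::
  "(nat \<times> 'v::finite mon \<Rightarrow> nat \<times> 'v mon \<Rightarrow> bool) \<Rightarrow> ('v, 'k::field) vec \<Rightarrow> ('v, 'k) vec \<Rightarrow>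
   ('v, 'k) mpoly" where
  "cofactor ord v w = Poly_Mapping.single
     (lcm_mon (snd (lm ord v)) (snd (lm ord w)) - snd (lm ord v)) (1 / lc ord v)"

text \<open>\<open>D p\<close> is the column of \<open>\<partial>\<^sub>1\<close> belonging to the pair \<open>p\<close>, and \<open>D p j\<close> its entry in row \<open>j\<close>.
  \<open>D\<close> is not unique since the division algorithm may make choices.\<close>

definition schreyer_matrix ::
  "(nat \<times> 'v::finite mon \<Rightarrow> nat \<times> 'v mon \<Rightarrow> bool) \<Rightarrow> nat \<Rightarrow> nat set \<Rightarrow> ('v gidx \<Rightarrow> ('v, 'k::field) vec) \<Rightarrow>
   (nat \<times> 'v gidx \<Rightarrow> ('v, 'k) vec) \<Rightarrow> bool" where
  "schreyer_matrix ord s J g D \<longleftrightarrow>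
     (\<forall>(i, l)\<in>spairs ord s J g. \<exists>a.
        division ord s J g
          (pscale (cofactor ord (g (Inl i)) (g l)) (g (Inl i))
           - pscale (cofactor ord (g l) (g (Inl i))) (g l)) a \<and>
        D (i, l) = (\<lambda>j. if j \<in> J then
            (if j = i then cofactor ord (g (Inl i)) (g l) else 0)
            - (if Inl j = l then cofactor ord (g l) (g (Inl i)) else 0)
            - a (Inl j)
          else 0))"


section \<open>Pruning\<close>

text \<open>A state consists of the remaining rows, the remaining columns and the entries
  \<open>D p j\<close>. A step uses the non-zero constant entry \<open>c\<close> in row \<open>j\<close> and column \<open>p\<close> as pivot.\<close>

type_synonym ('v, 'k, 'p) prune_state = "nat set \<times> 'p set \<times> ('p \<Rightarrow> ('v, 'k) vec)"

inductive prune_step ::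
  "('v, 'k::field, 'p) prune_state \<Rightarrow> ('v, 'k, 'p) prune_state \<Rightarrow> bool" where
  "prune_step (J, P, D)
     (J - {j}, P - {p}, \<lambda>q. D q - pscale (cst (1 / c) * D q j) (D p))"
  if "j \<in> J" and "p \<in> P" and "c \<noteq> 0" and "D p j = cst c"

definition pruned :: "('v, 'k::field, 'p) prune_state \<Rightarrow> bool" where
  "pruned S \<longleftrightarrow> (case S of (J, P, D) \<Rightarrow> \<forall>j\<in>J. \<forall>p\<in>P. \<forall>c. D p j = cst c \<longrightarrow> c = 0)"

end

theory Submission
  imports Defs
begin

text \<open>
  Everything is graded by \<open>\<int>\<^sup>n\<close>, and all terms of a homogeneous element of \<open>R\<^sup>s\<close> have the
  same monomial. Such an element is a vector in \<open>k\<^sup>s\<close>, and a position-over-term order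
  compares its terms by their positions only. Since \<open>U\<close>, \<open>V\<close> and the kernel of \<open>\<phi>\<close> are
  graded, leading term arguments become linear algebra in one degree at a time,
  and inductions over monomials are replaced by inductions over the finitely many
  positions.

  The map \<open>\<phi>\<close> factors as \<open>F\<^sub>0 \<rightarrow> R\<^sup>s \<rightarrow> E\<^sub>0\<close>. The first map sends the \<open>j\<close>-th basis element
  to \<open>h\<^sub>j\<close> (\<open>column_sum\<close>), the second is \<open>cofree_embedding\<close>, and its kernel is \<open>U\<close>
  (\<open>phi_eq_cofree_embedding\<close>, \<open>cofree_embedding_eq_0_iff\<close>). Hence the kernel of \<open>\<phi>\<close> consists
  of the \<open>f\<close> with \<open>\<Sum>\<^sub>j f\<^sub>j h\<^sub>j \<in> U\<close>, the syzygies of the \<open>h\<^sub>j\<close> relative to \<open>U\<close>, and the image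
  of \<open>\<phi>\<close> is isomorphic to \<open>V/U\<close>.

  A presentation is brought into Groebner form by adding, for every leading monomial
  of \<open>V\<close> outside \<open>lm(U)\<close>, a homogeneous element of \<open>V\<close> that has it as its leading monomial
  (\<open>groebner_completion_exists\<close>). There are finitely many such monomials, because each
  of them gives a degree in which the image of \<open>\<phi>\<close>, that is \<open>M\<close>, is not zero.

  In Groebner form the columns of \<open>\<partial>\<^sub>1\<close> generate the kernel of \<open>\<phi>\<close> (\<open>schreyer\<close>). In a
  homogeneous syzygy, consider the highest position reached by the leading monomials
  of the \<open>f\<^sub>j h\<^sub>j\<close>. The terms there either lie in \<open>U\<close> or cancel each other. Both cases
  provide an S-pair (\<open>reducing_pair\<close>), and subtracting a multiple of its column from the
  syzygy removes one of these terms, while new terms appear only at lower positions.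

  A pruning step with its pivot in row \<open>j\<close> expresses the \<open>j\<close>-th generator by the others. So
  the image of \<open>\<phi>\<close> does not change, and the modified columns generate the relations
  between the remaining generators (\<open>prune_step_presents\<close>). The columns stay homogeneous,
  so when no non-zero constant entry is left, all entries lie in \<open>\<mm>\<close>. The kernel, which
  the columns generate, is then contained in \<open>\<mm> F\<^sub>0\<close>.
\<close>


abbreviation (input) "lookup \<equiv> Poly_Mapping.lookup"
abbreviation (input) "single \<equiv> Poly_Mapping.single"
abbreviation (input) "keys \<equiv> Poly_Mapping.keys"

section \<open>Monomials and polynomials\<close>

lemma lookup_mon_of [simp]: "lookup (mon_of \<gamma>) k = nat (\<gamma> k)"
  unfolding mon_of_def by (subst Poly_Mapping.lookup_Abs_poly_mapping) auto

lemma lookup_lcm_mon [simp]: "lookup (lcm_mon a b) k = max (lookup a k) (lookup b k)"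
  unfolding lcm_mon_def by (subst Poly_Mapping.lookup_Abs_poly_mapping) auto

lemma mon_dvd_iff: "mon_dvd a b \<longleftrightarrow> (\<forall>k. lookup a k \<le> lookup b k)"
proof
  assume "\<forall>k. lookup a k \<le> lookup b k"
  then have "b = a + (b - a)"
    by (intro poly_mapping_eqI) (simp add: lookup_add lookup_minus)
  then show "mon_dvd a b" unfolding mon_dvd_def by blast
qed (auto simp: mon_dvd_def lookup_add)

lemma mon_dvd_refl [simp]: "mon_dvd a a"
  by (simp add: mon_dvd_iff)

lemma mon_dvd_add [simp]: "mon_dvd a (a + b)" "mon_dvd b (a + b)"
  by (auto simp: mon_dvd_iff lookup_add)

lemma mon_dvd_trans: "mon_dvd a b \<Longrightarrow> mon_dvd b c \<Longrightarrow> mon_dvd a c"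
  unfolding mon_dvd_iff using order_trans by blast

lemma mon_add_diff: "mon_dvd a b \<Longrightarrow> a + (b - a) = b"
  by (auto simp: mon_dvd_def)

lemma mon_diff_add: "mon_dvd a b \<Longrightarrow> b - a + a = b"
  by (auto simp: mon_dvd_def add.commute)

lemma mon_diff_diff: "mon_dvd a b \<Longrightarrow> b - (b - a) = a"
  by (auto simp: mon_dvd_def)

lemma mon_diff_dvd: "mon_dvd a b \<Longrightarrow> mon_dvd (b - a) b"
  by (auto simp: mon_dvd_iff lookup_minus)

lemma mon_dvd_lcm: "mon_dvd a (lcm_mon a b)" "mon_dvd b (lcm_mon a b)"
  by (auto simp: mon_dvd_iff)

lemma lcm_mon_dvd: "mon_dvd a c \<Longrightarrow> mon_dvd b c \<Longrightarrow> mon_dvd (lcm_mon a b) c"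
  by (auto simp: mon_dvd_iff)

lemma lcm_mon_commute: "lcm_mon a b = lcm_mon b a"
  by (intro poly_mapping_eqI) (simp add: max.commute)

lemma deg_of_nonneg: "0 \<le> deg_of a"
  by (auto simp: deg_of_def le_fun_def)

lemma deg_of_mon_of: "0 \<le> \<gamma> \<Longrightarrow> deg_of (mon_of \<gamma>) = \<gamma>"
  by (auto simp: deg_of_def le_fun_def)

lemma mon_of_deg_of [simp]: "mon_of (deg_of a) = a"
  by (intro poly_mapping_eqI) (simp add: deg_of_def)

lemma mon_dvd_iff_deg: "mon_dvd a b \<longleftrightarrow> deg_of a \<le> deg_of b"
  by (auto simp: deg_of_def le_fun_def mon_dvd_iff)

lemma deg_of_diff: "mon_dvd a b \<Longrightarrow> deg_of (b - a) = deg_of b - deg_of a"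
  by (auto simp: deg_of_def fun_eq_iff mon_dvd_iff lookup_minus of_nat_diff)

lemma deg_of_inject: "deg_of a = deg_of b \<longleftrightarrow> a = b"
  by (auto simp: deg_of_def fun_eq_iff poly_mapping_eq_iff)

lemma sum_single_keys: "p = (\<Sum>b\<in>keys p. single b (lookup p b))"
  by (intro poly_mapping_eqI)
     (auto simp: lookup_sum lookup_single when_def sum.delta in_keys_iff)

lemma lookup_times_single:
  fixes p :: "('v, 'k::field) mpoly"
  shows "lookup (p * single b c) a = (if mon_dvd b a then lookup p (a - b) * c else 0)"
proof -
  have "p * single b c = (\<Sum>d\<in>keys p. single (d + b) (lookup p d * c))"
  proof -
    have "p * single b c = (\<Sum>d\<in>keys p. single d (lookup p d)) * single b c"
      using arg_cong[OF sum_single_keys[of p], of "\<lambda>q. q * single b c"] .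
    then show ?thesis by (simp only: sum_distrib_right mult_single)
  qed
  then have "lookup (p * single b c) a = (\<Sum>d\<in>keys p. (lookup p d * c when d + b = a))"
    by (simp add: lookup_sum lookup_single)
  also have "\<dots> = (if mon_dvd b a then lookup p (a - b) * c else 0)"
  proof (cases "mon_dvd b a")
    case True
    then have "d + b = a \<longleftrightarrow> d = a - b" for d
      using mon_diff_add[OF True] by auto
    then show ?thesis using True
      by (auto simp: when_def in_keys_iff)
  next
    case False
    then have "d + b \<noteq> a" for d by auto
    then show ?thesis using False by (simp add: when_def)
  qed
  finally show ?thesis .
qed

lemma lookup_single_times:
  fixes p :: "('v, 'k::field) mpoly"
  shows "lookup (single b c * p) a = (if mon_dvd b a then c * lookup p (a - b) else 0)"
  using lookup_times_single[of p b c a] by (simp add: mult.commute)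

text \<open>As \<open>X\<^sup>b X\<^bsup>-m\<^esup> = X\<^bsup>-x\<^esup>\<close> means \<open>b = m - x\<close>, contraction with one monomial reads the coefficients
  of \<open>p\<close> in reverse order.\<close>

lemma lookup_contr_single:
  fixes p :: "('v, 'k::field) mpoly"
  shows "lookup (contr p (single m c)) x = (if mon_dvd x m then lookup p (m - x) * c else 0)"
proof -
  have "{a \<in> keys (single m c). mon_dvd b a} = (if c \<noteq> 0 \<and> mon_dvd b m then {m} else {})" for b
    by auto
  then have "contr p (single m c) = (\<Sum>b\<in>keys p. if mon_dvd b m then single (m - b) (lookup p b * c) else 0)"
    unfolding contr_def by (intro sum.cong) auto
  then have "lookup (contr p (single m c)) x
      = (\<Sum>b\<in>keys p. if mon_dvd b m \<and> m - b = x then lookup p b * c else 0)"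
    by (auto simp: lookup_sum lookup_single when_def intro!: sum.cong)
  also have "\<dots> = (\<Sum>b\<in>keys p. if b = m - x then (if mon_dvd x m then lookup p b * c else 0) else 0)"
  proof (intro sum.cong refl)
    fix b
    have "mon_dvd b m \<and> m - b = x \<longleftrightarrow> b = m - x \<and> mon_dvd x m"
      using mon_diff_diff[of b m] mon_diff_dvd[of b m] mon_diff_diff[of x m] mon_diff_dvd[of x m] by auto
    then show "(if mon_dvd b m \<and> m - b = x then lookup p b * c else 0)
      = (if b = m - x then (if mon_dvd x m then lookup p b * c else 0) else 0)" by auto
  qed
  also have "\<dots> = (if mon_dvd x m then lookup p (m - x) * c else 0)"
    by (auto simp: in_keys_iff)
  finally show ?thesis .
qed

section \<open>Supports and homogeneous elements\<close>

interpretation R: module "pscale :: ('v, 'k::field) mpoly \<Rightarrow> ('v, 'k) vec \<Rightarrow> ('v, 'k) vec"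
  by (rule module_pscale)

interpretation K: module "\<lambda>c. pscale (cst c) :: ('v, 'k::field) vec \<Rightarrow> ('v, 'k) vec"
  by standard
    (auto simp: pscale_def cst_def fun_eq_iff algebra_simps Poly_Mapping.single_add mult_single)

lemma pscale_apply: "pscale p v i = p * v i"
  by (simp add: pscale_def)

lemma sum_fun_apply: "(\<Sum>x\<in>A. f x) i = (\<Sum>x\<in>A. f x i)"
  by (induction A rule: infinite_finite_induct) auto

lemma keys_subset_singleton: "keys p \<subseteq> {a} \<Longrightarrow> p = single a (lookup p a)"
  by (intro poly_mapping_eqI) (auto simp: lookup_single when_def in_keys_iff)

lemma lookup_cst_times [simp]: "lookup (cst c * p) a = c * lookup p a"
  by (simp add: cst_def lookup_single_times mon_dvd_iff)

text \<open>\<open>B j\<close> is the degree of the \<open>j\<close>-th basis element, all degrees being written as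
  monomials. For \<open>B = 0\<close> these are the homogeneous elements of \<open>R\<^sup>s\<close>: every component is a
  scalar times one and the same monomial, so such an element is a vector in \<open>k\<^sup>s\<close>.\<close>

definition homogeneous :: "(nat \<Rightarrow> 'v mon) \<Rightarrow> 'v mon \<Rightarrow> ('v, 'k::field) vec \<Rightarrow> bool" where
  "homogeneous B m f \<longleftrightarrow> (\<forall>j. \<forall>b\<in>keys (f j). B j + b = m)"

lemma homogeneous_zero [simp]: "homogeneous B m 0"
  by (simp add: homogeneous_def)

lemma homogeneous_add: "homogeneous B m f \<Longrightarrow> homogeneous B m g \<Longrightarrow> homogeneous B m (f + g)"
  unfolding homogeneous_def using Poly_Mapping.keys_add by fastforce

lemma homogeneous_diff: "homogeneous B m f \<Longrightarrow> homogeneous B m g \<Longrightarrow> homogeneous B m (f - g)"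
  unfolding homogeneous_def using Poly_Mapping.keys_diff by fastforce

lemma homogeneous_scale:
  assumes "homogeneous B m f" and "keys p \<subseteq> {b}"
  shows "homogeneous B (m + b) (pscale p f)"
  unfolding homogeneous_def
proof (intro allI ballI)
  fix j c assume "c \<in> keys (pscale p f j)"
  then obtain x y where "x \<in> keys p" "y \<in> keys (f j)" "c = x + y"
    using Poly_Mapping.keys_mult[of p "f j"] by (auto simp: pscale_apply)
  then show "B j + c = m + b"
    using assms by (auto simp: homogeneous_def add_ac)
qed

lemma homogeneous_scale_single:
  assumes "homogeneous B n f" and "mon_dvd n m"
  shows "homogeneous B m (pscale (single (m - n) c) f)"
  using homogeneous_scale[OF assms(1), of "single (m - n) c" "m - n"] assms(2)
  by (auto simp: mon_add_diff)

lemma homogeneous_sum: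
  "(\<And>x. x \<in> I \<Longrightarrow> homogeneous B m (f x)) \<Longrightarrow> homogeneous B m (\<Sum>x\<in>I. f x)"
  by (induction I rule: infinite_finite_induct) (auto intro: homogeneous_add)

lemma homogeneous_entry:
  assumes "homogeneous B m f"
  shows "f j = (if mon_dvd (B j) m then single (m - B j) (lookup (f j) (m - B j)) else 0)"
proof -
  have *: "b = m - B j \<and> mon_dvd (B j) m" if "b \<in> keys (f j)" for b
    using assms that unfolding homogeneous_def by fastforce
  show ?thesis
  proof (cases "mon_dvd (B j) m")
    case True
    then show ?thesis using * keys_subset_singleton[of "f j" "m - B j"] by auto
  next
    case False
    then have "keys (f j) = {}" using * by blast
    then show ?thesis using False by simp
  qed
qed

lemma homogeneous_mon_dvd:
  "homogeneous B m f \<Longrightarrow> f j \<noteq> 0 \<Longrightarrow> mon_dvd (B j) m"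
  using homogeneous_entry[of B m f j] by (auto split: if_splits)

lemma homogeneous_eq_0_iff:
  "homogeneous B m f \<Longrightarrow> f j = 0 \<longleftrightarrow> lookup (f j) (m - B j) = 0"
  using homogeneous_entry[of B m f j] by (auto split: if_splits)

definition component :: "(nat \<Rightarrow> 'v mon) \<Rightarrow> 'v mon \<Rightarrow> ('v, 'k::field) vec \<Rightarrow> ('v, 'k) vec" where
  "component B m f =
     (\<lambda>j. if mon_dvd (B j) m then single (m - B j) (lookup (f j) (m - B j)) else 0)"

lemma homogeneous_component: "homogeneous B m (component B m f)"
  unfolding homogeneous_def component_def by (auto simp: mon_add_diff split: if_splits)

lemma component_zero [simp]: "component B m 0 = 0"
  by (auto simp: component_def fun_eq_iff)

lemma component_add: "component B m (f + g) = component B m f + component B m g"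
  by (auto simp: component_def fun_eq_iff lookup_add Poly_Mapping.single_add)

text \<open>The degree \<open>m\<close> part of \<open>p f\<close> comes from the single term of \<open>p\<close> of degree \<open>m - n\<close>.\<close>

lemma component_scale:
  assumes "homogeneous B n f"
  shows "component B m (pscale p f) =
    (if mon_dvd n m then pscale (single (m - n) (lookup p (m - n))) f else 0)"
proof (rule ext)
  fix j
  show "component B m (pscale p f) j =
    (if mon_dvd n m then pscale (single (m - n) (lookup p (m - n))) f else 0) j"
  proof (cases "mon_dvd (B j) n")
    case False
    then have "f j = 0" using homogeneous_mon_dvd[OF assms] by blast
    then show ?thesis by (simp add: component_def pscale_apply)
  next
    case True
    define c where "c = lookup (f j) (n - B j)"
    have f: "f j = single (n - B j) c"
      using homogeneous_entry[OF assms, of j] True by (simp add: c_def)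
    have eq: "mon_dvd (B j) m \<and> mon_dvd (n - B j) (m - B j) \<longleftrightarrow> mon_dvd n m"
    proof -
      have "lookup (B j) k \<le> lookup m k \<and> lookup n k - lookup (B j) k \<le> lookup m k - lookup (B j) k
          \<longleftrightarrow> lookup n k \<le> lookup m k" for k
        using True[unfolded mon_dvd_iff, rule_format, of k] by arith
      then show ?thesis unfolding mon_dvd_iff by (auto simp: lookup_minus)
    qed
    have d: "m - B j - (n - B j) = m - n" "m - n + (n - B j) = m - B j" if "mon_dvd n m"
      using True that unfolding mon_dvd_iff
      by (auto intro!: poly_mapping_eqI simp: lookup_minus lookup_add)
    show ?thesis
      using eq d by (auto simp: component_def f lookup_times_single mult_single pscale_apply)
  qed
qed

text \<open>A component of \<open>p x\<close> with \<open>x\<close> homogeneous is a term of \<open>p\<close> times \<open>x\<close>, hence stays in the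
  span; and taking components is additive.\<close>

lemma component_in_span:
  assumes hom: "\<And>x. x \<in> S \<Longrightarrow> \<exists>n. homogeneous B n x" and "v \<in> R.span S"
  shows "component B m v \<in> R.span S"
  using \<open>v \<in> R.span S\<close>
proof (induction rule: R.span_induct_alt)
  case base
  show ?case
    unfolding component_zero by (rule R.span_zero)
next
  case (step p x y)
  obtain n where n: "homogeneous B n x" using hom[OF step(1)] by blast
  show ?case
    unfolding component_add component_scale[OF n]
    using step(1,2) by (cases "mon_dvd n m")
      (simp_all only: if_True if_False add_0_left R.span_add R.span_scale R.span_base)
qed

lemma sum_components:
  fixes f :: "('v, 'k::field) vec"
  assumes "finite J" and "\<And>j. j \<notin> J \<Longrightarrow> f j = 0"
  shows "\<exists>T. finite T \<and> f = (\<Sum>m\<in>T. component B m f)"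
proof (intro exI conjI)
  let ?T = "\<Union>j\<in>J. (\<lambda>b. B j + b) ` keys (f j)"
  show fin: "finite ?T" using assms(1) by simp
  show "f = (\<Sum>m\<in>?T. component B m f)"
  proof (rule ext, rule poly_mapping_eqI)
    fix j b
    have "lookup (component B m f j) b = (if m = B j + b then lookup (f j) b else 0)" for m
      by (auto simp: component_def lookup_single when_def mon_add_diff)
    then have *: "lookup ((\<Sum>m\<in>?T. component B m f) j) b
        = (if B j + b \<in> ?T then lookup (f j) b else 0)"
      using fin by (simp add: sum_fun_apply lookup_sum)
    have "B j + b \<in> ?T" if "lookup (f j) b \<noteq> 0"
      using that assms(2)[of j] by (cases "j \<in> J") (auto simp: in_keys_iff intro!: bexI[of _ j])
    then show "lookup (f j) b = lookup ((\<Sum>m\<in>?T. component B m f) j) b"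
      unfolding * by auto
  qed
qed


section \<open>Monomial submodules\<close>

lemma single_eq_0_iff [simp]: "single a c = 0 \<longleftrightarrow> c = 0"
  using Poly_Mapping.lookup_single_eq[of a c] by fastforce

lemma in_supp_iff: "(i, a) \<in> supp v \<longleftrightarrow> lookup (v i) a \<noteq> 0"
  by (simp add: supp_def in_keys_iff)

lemma supp_zero [simp]: "supp 0 = {}"
  by (auto simp: supp_def)

lemma supp_empty_iff: "supp v = {} \<longleftrightarrow> v = 0"
  by (auto simp: supp_def fun_eq_iff)

lemma supp_add: "supp (v + w) \<subseteq> supp v \<union> supp w"
  by (auto simp: supp_def in_keys_iff lookup_add)

lemma supp_scale: "supp (pscale p v) \<subseteq> {(i, a + b) | i a b. (i, a) \<in> supp v}"
proof
  fix m assume "m \<in> supp (pscale p v)"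
  then obtain i c where m: "m = (i, c)" "c \<in> keys (p * v i)"
    by (auto simp: supp_def pscale_apply)
  then obtain x y where "c = x + y" "y \<in> keys (v i)"
    using Poly_Mapping.keys_mult[of p "v i"] by auto
  then have "m = (i, y + x)" "(i, y) \<in> supp v"
    using m by (auto simp: supp_def add.commute)
  then show "m \<in> {(i, a + b) | i a b. (i, a) \<in> supp v}" by blast
qed

lemma supp_mvec [simp]: "supp (mvec m :: ('v, 'k::field) vec) = {m}"
  by (cases m) (auto simp: supp_def mvec_def split: if_splits)

lemma mvec_neq_0 [simp]: "(mvec m :: ('v, 'k::field) vec) \<noteq> 0"
  by (metis supp_mvec supp_zero insert_not_empty)

lemma homogeneous_mvec: "homogeneous (\<lambda>_. 0) (snd m) (mvec m)"
  by (auto simp: homogeneous_def mvec_def)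

lemma finite_supp:
  assumes "supp v \<subseteq> {..<s::nat} \<times> UNIV"
  shows "finite (supp v)"
proof -
  have "supp v \<subseteq> (SIGMA i:{..<s}. keys (v i))"
    using assms by (auto simp: supp_def)
  then show ?thesis by (rule finite_subset) simp
qed

lemma sum_of_terms:
  fixes v :: "('v, 'k::field) vec"
  assumes "finite (supp v)"
  shows "v = (\<Sum>m\<in>supp v. pscale (cst (lookup (v (fst m)) (snd m))) (mvec m))"
proof (rule ext, rule poly_mapping_eqI)
  fix i a
  have "lookup ((\<Sum>m\<in>supp v. pscale (cst (lookup (v (fst m)) (snd m))) (mvec m)) i) a
    = (\<Sum>m\<in>supp v. if m = (i, a) then lookup (v i) a else 0)"
    unfolding sum_fun_apply lookup_sum
    by (intro sum.cong refl)
       (auto simp: pscale_apply mvec_def lookup_single when_def prod_eq_iff split: if_splits)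
  also have "\<dots> = lookup (v i) a"
    using assms by (auto simp: in_supp_iff)
  finally show "lookup (v i) a
    = lookup ((\<Sum>m\<in>supp v. pscale (cst (lookup (v (fst m)) (snd m))) (mvec m)) i) a" ..
qed

definition multiples :: "(nat \<times> 'v mon) set \<Rightarrow> (nat \<times> 'v mon) set" where
  "multiples T = {(i, a). \<exists>b. mon_dvd b a \<and> (i, b) \<in> T}"

lemma multiples_closed: "(i, a) \<in> multiples T \<Longrightarrow> (i, a + b) \<in> multiples T"
  unfolding multiples_def using mon_dvd_trans mon_dvd_add(1) by blast

lemma span_mvec_field:
  assumes "T \<subseteq> {..<s} \<times> UNIV"
  shows "K.span (mvec ` T :: ('v, 'k::field) vec set) = {v. supp v \<subseteq> T}" (is "?L = ?R")
proof
  have "supp (pscale (cst c) v) \<subseteq> supp v" for c and v :: "('v, 'k) vec"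
    by (auto simp: supp_def pscale_apply in_keys_iff)
  then have "K.subspace ?R"
    unfolding K.subspace_def
    by (intro conjI ballI allI CollectI) (use supp_add in \<open>force, force, blast\<close>)
  then show "?L \<subseteq> ?R"
    by (intro K.span_minimal) auto
  show "?R \<subseteq> ?L"
  proof
    fix v :: "('v, 'k) vec" assume v: "v \<in> ?R"
    then have "finite (supp v)" using assms finite_supp by blast
    moreover have "pscale (cst c) (mvec m) \<in> ?L" if "m \<in> supp v" for c m
      using that v by (intro K.span_scale K.span_base) auto
    ultimately show "v \<in> ?L"
      by (subst sum_of_terms) (auto intro!: K.span_sum)
  qed
qed

text \<open>The set of multiples is closed under multiplication by monomials.\<close>

lemma subspace_supp_multiples: "R.subspace {v :: ('v, 'k::field) vec. supp v \<subseteq> multiples T}"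
  unfolding R.subspace_def
proof (intro conjI ballI allI)
  fix p and v :: "('v, 'k::field) vec" assume "v \<in> {v. supp v \<subseteq> multiples T}"
  then show "pscale p v \<in> {v. supp v \<subseteq> multiples T}"
    using supp_scale[of p v] by (auto intro: multiples_closed)
next
  fix v w :: "('v, 'k::field) vec"
  assume "v \<in> {v. supp v \<subseteq> multiples T}" "w \<in> {v. supp v \<subseteq> multiples T}"
  then show "v + w \<in> {v. supp v \<subseteq> multiples T}"
    using supp_add[of v w] by auto
qed auto

lemma span_mvec_ring:
  assumes "T \<subseteq> {..<s} \<times> UNIV"
  shows "R.span (mvec ` T :: ('v, 'k::field) vec set) = {v. supp v \<subseteq> multiples T}" (is "?L = ?R")
proof
  show "?L \<subseteq> ?R"
  proof (rule R.span_minimal)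
    show "mvec ` T \<subseteq> ?R"
      by (auto simp: multiples_def intro: mon_dvd_refl)
  qed (rule subspace_supp_multiples)
  show "?R \<subseteq> ?L"
  proof
    fix v :: "('v, 'k) vec" assume v: "v \<in> ?R"
    then have fin: "finite (supp v)"
      using assms by (intro finite_supp[of v s]) (auto simp: multiples_def)
    have "pscale (cst c) (mvec m) \<in> ?L" if m: "m \<in> supp v" for c m
    proof -
      obtain b where b: "mon_dvd b (snd m)" "(fst m, b) \<in> T"
        using m v by (cases m) (auto simp: multiples_def)
      then have "mvec m = pscale (single (snd m - b) 1) (mvec (fst m, b) :: ('v, 'k) vec)"
        by (auto simp: mvec_def pscale_apply fun_eq_iff mult_single mon_diff_add)
      then show ?thesis
        using b by (simp only:) (intro R.span_scale R.span_base imageI)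
    qed
    then show "v \<in> ?L"
      by (subst sum_of_terms[OF fin]) (intro R.span_sum)
  qed
qed

definition U_monomials :: "nat \<Rightarrow> (nat \<Rightarrow> 'v deg) \<Rightarrow> (nat \<times> 'v mon) set" where
  "U_monomials s \<alpha> = {(i, a). i < s \<and> \<not> deg_of a \<le> \<alpha> i}"

lemma single_dvd_iff:
  "mon_dvd (single k (nat (c + 1))) a \<longleftrightarrow> \<not> int (lookup a k) \<le> c"
proof
  assume "mon_dvd (single k (nat (c + 1))) a"
  then have "nat (c + 1) \<le> lookup a k"
    unfolding mon_dvd_iff by (metis Poly_Mapping.lookup_single_eq)
  then show "\<not> int (lookup a k) \<le> c" by linarith
qed (auto simp: mon_dvd_iff lookup_single when_def)

text \<open>\<open>X\<^sup>a\<close> is divisible by some \<open>X\<^sub>k\<^bsup>\<alpha> i k + 1\<^esup>\<close> exactly if \<open>a \<le> \<alpha> i\<close> fails. This includes the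
  truncated exponent \<open>0\<close>, where \<open>\<alpha> i k\<close> is negative and \<open>a \<le> \<alpha> i\<close> fails for all \<open>a\<close>.\<close>

lemma Umod_eq: "(Umod s \<alpha> :: ('v, 'k::field) vec set) = {v. supp v \<subseteq> U_monomials s \<alpha>}"
proof -
  let ?T = "{(i, single k (nat (\<alpha> i k + 1))) | i k. i < s}"
  have "{gE \<alpha> i k | i k. i < s} = (mvec ` ?T :: ('v, 'k) vec set)"
    by (auto simp: gE_def)
  moreover have "multiples ?T = U_monomials s \<alpha>"
  proof -
    have "(i, a) \<in> multiples ?T \<longleftrightarrow>
        i < s \<and> (\<exists>k. mon_dvd (single k (nat (\<alpha> i k + 1))) a)" for i a
      unfolding multiples_def by blast
    then show ?thesis
      by (auto simp: single_dvd_iff U_monomials_def deg_of_def le_fun_def)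
  qed
  ultimately show ?thesis
    unfolding Umod_def by (simp only:) (rule trans[OF span_mvec_ring[of _ s]], auto)
qed

lemma subspace_Umod: "R.subspace (Umod s \<alpha>)"
  unfolding Umod_def by (rule R.subspace_span)

lemma homogeneous_in_Umod_iff:
  assumes "homogeneous (\<lambda>_. 0) a v" and "\<And>i. s \<le> i \<Longrightarrow> v i = 0"
  shows "v \<in> Umod s \<alpha> \<longleftrightarrow> (\<forall>i<s. deg_of a \<le> \<alpha> i \<longrightarrow> v i = 0)"
proof -
  have 1: "b = a" if "b \<in> keys (v i)" for b i
    using assms(1) that by (auto simp: homogeneous_def)
  have 2: "a \<in> keys (v i) \<longleftrightarrow> v i \<noteq> 0" for i
    using 1 by (metis Poly_Mapping.keys_eq_empty all_not_in_conv)
  have 3: "i < s" if "v i \<noteq> 0" for i using assms(2) that not_less by blast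
  show ?thesis
    unfolding Umod_eq U_monomials_def supp_def using 1 2 3 by (auto, blast+)
qed

section \<open>Position-over-term orders\<close>

text \<open>The order on positions is encoded by a rank in \<open>\<nat>\<close>, so that inductions over positions
  become inductions over natural numbers.\<close>

locale position_order =
  fixes s :: nat and ord :: "nat \<times> 'v::finite mon \<Rightarrow> nat \<times> 'v mon \<Rightarrow> bool"
    and rk :: "nat \<Rightarrow> nat" and lt :: "'v mon \<Rightarrow> 'v mon \<Rightarrow> bool"
  assumes rk_inj: "inj_on rk {..<s}" and term_order: "term_order lt"
    and ord_iff: "\<And>i j a b. i < s \<Longrightarrow> j < s \<Longrightarrow>
          ord (i, a) (j, b) \<longleftrightarrow> rk i < rk j \<or> (i = j \<and> lt a b)"
begin

lemma rk_eq_iff: "i < s \<Longrightarrow> j < s \<Longrightarrow> rk i = rk j \<longleftrightarrow> i = j"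
  using rk_inj by (auto simp: inj_on_def)

lemma
  assumes "m \<in> {..<s} \<times> UNIV" "m' \<in> {..<s} \<times> UNIV"
  shows ord_irrefl: "\<not> ord m m"
    and ord_total: "m \<noteq> m' \<Longrightarrow> ord m m' \<or> ord m' m"
    and ord_trans: "m'' \<in> {..<s} \<times> UNIV \<Longrightarrow> ord m m' \<Longrightarrow> ord m' m'' \<Longrightarrow> ord m m''"
  using assms term_order rk_eq_iff
  unfolding term_order_def
  by (auto simp: ord_iff irreflp_def totalp_on_def dest: transpD)
     (metis nat_neq_iff order.strict_trans)+

lemma ex_greatest_monomial:
  assumes "finite F" "F \<noteq> {}" "F \<subseteq> {..<s} \<times> UNIV"
  shows "\<exists>m\<in>F. \<forall>m'\<in>F. m' \<noteq> m \<longrightarrow> ord m' m"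
  using assms
proof (induction F rule: finite_ne_induct)
  case (insert x F)
  then obtain m where m: "m \<in> F" "\<forall>m'\<in>F. m' \<noteq> m \<longrightarrow> ord m' m" by auto
  have in_s: "x \<in> {..<s} \<times> UNIV" "m \<in> {..<s} \<times> UNIV" "m' \<in> F \<Longrightarrow> m' \<in> {..<s} \<times> UNIV" for m'
    using insert m by auto
  have "x \<noteq> m" using insert m by auto
  then consider "ord x m" | "ord m x" using ord_total in_s by blast
  then show ?case
  proof cases
    case 1
    then show ?thesis using m by auto
  next
    case 2
    then have "ord m' x" if "m' \<in> F" for m'
      using that m in_s ord_trans[of m' m x] by (cases "m' = m") auto
    then show ?thesis by auto
  qed
qed auto

lemma lm_eqI:
  assumes "supp v \<subseteq> {..<s} \<times> UNIV" and "m \<in> supp v"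
    and "\<And>m'. m' \<in> supp v \<Longrightarrow> m' \<noteq> m \<Longrightarrow> ord m' m"
  shows "lm ord v = m"
  unfolding lm_def
proof (rule the_equality)
  fix m' assume m': "m' \<in> supp v \<and> (\<forall>m''\<in>supp v. m'' \<noteq> m' \<longrightarrow> ord m'' m')"
  show "m' = m"
  proof (rule ccontr)
    assume "m' \<noteq> m"
    then have "ord m' m" "ord m m'" using m' assms by auto
    then show False
      using ord_trans[of m m' m] ord_irrefl[of m m] assms m' by blast
  qed
qed (use assms in auto)

lemma
  assumes "v \<noteq> 0" and "supp v \<subseteq> {..<s} \<times> UNIV"
  shows lm_in_supp: "lm ord v \<in> supp v"
    and lm_greatest: "m' \<in> supp v \<Longrightarrow> m' \<noteq> lm ord v \<Longrightarrow> ord m' (lm ord v)"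
proof -
  obtain m where m: "m \<in> supp v" "\<forall>m'\<in>supp v. m' \<noteq> m \<longrightarrow> ord m' m"
    using ex_greatest_monomial[of "supp v"] finite_supp assms supp_empty_iff by blast
  then have "lm ord v = m" using assms by (intro lm_eqI) auto
  then show "lm ord v \<in> supp v" "m' \<in> supp v \<Longrightarrow> m' \<noteq> lm ord v \<Longrightarrow> ord m' (lm ord v)"
    using m by auto
qed

text \<open>Among terms with the same monomial only the positions decide.\<close>

lemma lm_homogeneous_eqI:
  assumes "homogeneous (\<lambda>_. 0) a v" and "i < s" and "v i \<noteq> 0"
    and "\<And>j. v j \<noteq> 0 \<Longrightarrow> j < s \<and> (j = i \<or> rk j < rk i)"
  shows "lm ord v = (i, a)"
proof (rule lm_eqI)
  have *: "b = a \<and> v j \<noteq> 0" if "(j, b) \<in> supp v" for j b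
    using assms(1) that by (auto simp: homogeneous_def supp_def)
  show "supp v \<subseteq> {..<s} \<times> UNIV" using * assms(4) by auto
  show "(i, a) \<in> supp v"
    using homogeneous_eq_0_iff[OF assms(1), of i] assms(3) by (simp add: in_supp_iff)
  fix m' assume "m' \<in> supp v" "m' \<noteq> (i, a)"
  then show "ord m' (i, a)"
    using * assms(2,4) by (cases m') (auto simp: ord_iff)
qed

lemma lm_homogeneous:
  assumes "homogeneous (\<lambda>_. 0) a v" and "v \<noteq> 0" and "\<And>i. s \<le> i \<Longrightarrow> v i = 0"
  shows "\<exists>i<s. lm ord v = (i, a) \<and> v i \<noteq> 0 \<and> (\<forall>j. v j \<noteq> 0 \<longrightarrow> j < s \<and> (j = i \<or> rk j < rk i))"
proof -
  let ?I = "{j. v j \<noteq> 0}"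
  have I: "?I \<subseteq> {..<s}" using assms(3) not_less by blast
  then have fin: "finite (rk ` ?I)" using finite_subset by blast
  have "?I \<noteq> {}" using assms(2) by (auto simp: fun_eq_iff)
  then have "Max (rk ` ?I) \<in> rk ` ?I" using fin by (intro Max_in) auto
  then obtain i where i: "v i \<noteq> 0" "rk i = Max (rk ` ?I)" by auto
  have "j < s \<and> (j = i \<or> rk j < rk i)" if j: "v j \<noteq> 0" for j
  proof -
    have "rk j \<le> rk i" unfolding i(2) using fin j by (intro Max_ge) auto
    moreover have "i < s" "j < s" using I i j by auto
    ultimately show ?thesis using rk_eq_iff[of i j] by auto
  qed
  then show ?thesis using lm_homogeneous_eqI[OF assms(1), of i] i by blast
qed

definition lead_monomials :: "('v, 'k::field) vec set \<Rightarrow> (nat \<times> 'v mon) set" where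
  "lead_monomials W = {lm ord w | w. w \<in> W \<and> w \<noteq> 0}"

lemma lm_span_eq:
  assumes "\<And>w :: ('v, 'k::field) vec. w \<in> W \<Longrightarrow> supp w \<subseteq> {..<s} \<times> UNIV"
  shows "lm_span ord W = {v. supp v \<subseteq> lead_monomials W}"
proof -
  have "{mvec (lm ord w) | w. w \<in> W \<and> w \<noteq> 0} = (mvec ` lead_monomials W :: ('v, 'k) vec set)"
    by (auto simp: lead_monomials_def)
  moreover have "lead_monomials W \<subseteq> {..<s} \<times> UNIV"
    using assms lm_in_supp unfolding lead_monomials_def by blast
  ultimately show ?thesis
    by (simp only: lm_span_def) (rule span_mvec_field)
qed

text \<open>In the degree of the leading monomial of \<open>w\<close>, the component of \<open>w\<close> lies in \<open>W\<close> and
  keeps the leading monomial. Its other terms have the same monomial, so they are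
  smaller only because of their positions.\<close>

lemma lead_monomial_homogeneous:
  assumes "\<And>w m. w \<in> W \<Longrightarrow> component (\<lambda>_. 0) m w \<in> W"
    and bound: "\<And>w. w \<in> W \<Longrightarrow> supp w \<subseteq> {..<s} \<times> UNIV"
    and "(i, a) \<in> lead_monomials W"
  shows "\<exists>w\<in>W. homogeneous (\<lambda>_. 0) a w \<and> i < s \<and> w i \<noteq> 0 \<and>
      (\<forall>j. w j \<noteq> 0 \<longrightarrow> j < s \<and> (j = i \<or> rk j < rk i))"
proof -
  obtain w where w: "w \<in> W" "w \<noteq> 0" "lm ord w = (i, a)"
    using assms(3) by (auto simp: lead_monomials_def)
  let ?v = "component (\<lambda>_. 0) a w"
  have v: "?v j = single a (lookup (w j) a)" for j
    by (simp add: component_def mon_dvd_iff)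
  have ia: "(i, a) \<in> supp w" using lm_in_supp[OF w(2) bound[OF w(1)]] w by simp
  then have "i < s" using bound[OF w(1)] by blast
  moreover have "?v i \<noteq> 0" using ia by (simp add: v in_supp_iff)
  moreover have "j < s \<and> (j = i \<or> rk j < rk i)" if "?v j \<noteq> 0" for j
  proof -
    have j: "(j, a) \<in> supp w" using that by (auto simp: v in_supp_iff)
    then have "j < s" using bound[OF w(1)] by auto
    have "ord (j, a) (i, a)" if "j \<noteq> i"
      using lm_greatest[OF w(2) bound[OF w(1)] j] w(3) that by simp
    then show ?thesis
      using \<open>j < s\<close> \<open>i < s\<close> by (auto simp: ord_iff)
  qed
  ultimately show ?thesis
    using assms(1)[OF w(1), of a] homogeneous_component[of "\<lambda>_. 0" a w] by blast
qed

end

text \<open>The rank of a position is the number of positions below it.\<close>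

lemma pot_order_rank:
  assumes "pot_order s ord"
  shows "\<exists>rk lt. position_order s ord rk lt"
proof -
  obtain pos lt where pos: "irreflp_on {..<s} pos" "transp_on {..<s} pos" "totalp_on {..<s} pos"
    and lt: "term_order lt"
    and ord: "\<forall>i<s. \<forall>j<s. \<forall>a b. ord (i, a) (j, b) \<longleftrightarrow> pos i j \<or> (i = j \<and> lt a b)"
    using assms unfolding pot_order_def by blast
  define rk where "rk i = card {j. j < s \<and> pos j i}" for i
  have less: "rk i < rk j" if "i < s" "j < s" "pos i j" for i j
    unfolding rk_def
  proof (rule psubset_card_mono)
    have "{k. k < s \<and> pos k i} \<subseteq> {k. k < s \<and> pos k j}"
      using pos(2) that by (auto dest: transp_onD)
    moreover have "i \<notin> {k. k < s \<and> pos k i}" using pos(1) that by (auto dest: irreflp_onD)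
    ultimately show "{k. k < s \<and> pos k i} \<subset> {k. k < s \<and> pos k j}" using that by auto
  qed auto
  have iff: "pos i j \<longleftrightarrow> rk i < rk j" if "i < s" "j < s" for i j
  proof -
    have "i = j \<or> pos i j \<or> pos j i"
      using totalp_onD[OF pos(3), of i j] that by auto
    then show ?thesis
      using less[OF that] less[OF that(2,1)] irreflp_onD[OF pos(1), of i] that by auto
  qed
  have "inj_on rk {..<s}"
  proof (rule inj_onI, rule ccontr)
    fix i j assume "i \<in> {..<s}" "j \<in> {..<s}" "rk i = rk j" "i \<noteq> j"
    then show False using pos(3) less[of i j] less[of j i] by (auto simp: totalp_on_def)
  qed
  then have "position_order s ord rk lt"
    using lt ord iff by unfold_locales auto
  then show ?thesis by blast
qed


section \<open>The submodule V and the embedding into the cofree module\<close>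

lemma supp_bounded_iff: "supp v \<subseteq> {..<s} \<times> UNIV \<longleftrightarrow> (\<forall>i\<ge>s. v i = 0)"
proof -
  have "(\<exists>a. (i, a) \<in> supp v) \<longleftrightarrow> v i \<noteq> 0" for i
    by (simp add: supp_def ex_in_conv)
  moreover have "supp v \<subseteq> {..<s} \<times> UNIV \<longleftrightarrow> (\<forall>i. (\<exists>a. (i, a) \<in> supp v) \<longrightarrow> i < s)"
    by auto
  ultimately show ?thesis using not_less by auto
qed

lemma homogeneous_hcol: "homogeneous (\<lambda>_. 0) (mon_of (\<beta> j)) (hcol s \<beta> A j)"
  by (auto simp: homogeneous_def hcol_def split: if_splits)

lemma hcol_eq_0_iff: "hcol s \<beta> A j i = 0 \<longleftrightarrow> \<not> (i < s \<and> A i j \<noteq> 0)"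
  by (simp add: hcol_def)

lemma hcol_in_Umod_iff:
  assumes "\<And>i. i < s \<Longrightarrow> A i j \<noteq> 0 \<Longrightarrow> 0 \<le> \<beta> j \<and> \<beta> j \<le> \<alpha> i"
  shows "hcol s \<beta> A j \<in> Umod s \<alpha> \<longleftrightarrow> (\<forall>i<s. A i j = 0)"
proof -
  have "hcol s \<beta> A j \<in> Umod s \<alpha> \<longleftrightarrow> (\<forall>i<s. deg_of (mon_of (\<beta> j)) \<le> \<alpha> i \<longrightarrow> A i j = 0)"
    by (subst homogeneous_in_Umod_iff[OF homogeneous_hcol]) (auto simp: hcol_eq_0_iff hcol_def)
  moreover have "deg_of (mon_of (\<beta> j)) \<le> \<alpha> i" if "i < s" "A i j \<noteq> 0" for i
    using assms[OF that] by (simp add: deg_of_mon_of)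
  ultimately show ?thesis by blast
qed

lemma Vmod_eq_span:
  "Vmod s \<alpha> J \<beta> A = R.span (hcol s \<beta> A ` J \<union> {gE \<alpha> i k | i k. i < s})"
  unfolding Vmod_def Umod_def R.span_Un ..

lemma subspace_Vmod: "R.subspace (Vmod s \<alpha> J \<beta> A)"
  unfolding Vmod_eq_span by (rule R.subspace_span)

lemma hcol_in_Vmod: "j \<in> J \<Longrightarrow> hcol s \<beta> A j \<in> Vmod s \<alpha> J \<beta> A"
  unfolding Vmod_eq_span by (intro R.span_base) blast

lemma Umod_subset_Vmod: "Umod s \<alpha> \<subseteq> Vmod s \<alpha> J \<beta> A"
  unfolding Vmod_eq_span Umod_def by (intro R.span_mono) blast

lemma component_in_Vmod:
  "v \<in> Vmod s \<alpha> J \<beta> A \<Longrightarrow> component (\<lambda>_. 0) m v \<in> Vmod s \<alpha> J \<beta> A"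
  unfolding Vmod_eq_span
proof (rule component_in_span)
  fix x :: "('a, 'b) vec" assume "x \<in> hcol s \<beta> A ` J \<union> {gE \<alpha> i k | i k. i < s}"
  then show "\<exists>n. homogeneous (\<lambda>_. 0) n x"
    using homogeneous_hcol homogeneous_mvec unfolding gE_def by blast
qed

lemma Vmod_bounded:
  assumes "v \<in> Vmod s \<alpha> J \<beta> A"
  shows "\<forall>i\<ge>s. v i = 0"
proof -
  have "R.subspace {v. \<forall>i\<ge>s. v i = 0}"
    by (auto simp: R.subspace_def pscale_apply)
  then have "R.span (hcol s \<beta> A ` J \<union> {gE \<alpha> i k | i k. i < s}) \<subseteq> {v. \<forall>i\<ge>s. v i = 0}"
    by (intro R.span_minimal) (auto simp: hcol_def gE_def mvec_def)
  then show ?thesis using assms unfolding Vmod_eq_span by blast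
qed

definition column_sum ::
  "nat \<Rightarrow> (nat \<Rightarrow> 'v::finite deg) \<Rightarrow> (nat \<Rightarrow> nat \<Rightarrow> 'k::field) \<Rightarrow> nat set \<Rightarrow> ('v, 'k) vec \<Rightarrow> ('v, 'k) vec"
  where "column_sum s \<beta> A J f = (\<Sum>j\<in>J. pscale (f j) (hcol s \<beta> A j))"

lemma column_sum_zero [simp]: "column_sum s \<beta> A J 0 = 0"
  by (simp add: column_sum_def)

lemma column_sum_add:
  "column_sum s \<beta> A J (f + g) = column_sum s \<beta> A J f + column_sum s \<beta> A J g"
  by (simp only: column_sum_def plus_fun_apply R.scale_left_distrib sum.distrib)

lemma column_sum_diff:
  "column_sum s \<beta> A J (f - g) = column_sum s \<beta> A J f - column_sum s \<beta> A J g"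
  by (simp only: column_sum_def minus_apply R.scale_left_diff_distrib sum_subtractf)

lemma column_sum_scale:
  "column_sum s \<beta> A J (pscale p f) = pscale p (column_sum s \<beta> A J f)"
  by (simp only: column_sum_def pscale_apply R.scale_scale[symmetric] R.scale_sum_right)

lemma column_sum_unit:
  assumes "finite J" "j \<in> J"
  shows "column_sum s \<beta> A J (\<lambda>i. if i = j then p else 0) = pscale p (hcol s \<beta> A j)"
proof -
  have "column_sum s \<beta> A J (\<lambda>i. if i = j then p else 0)
      = (\<Sum>i\<in>J. if i = j then pscale p (hcol s \<beta> A j) else 0)"
    unfolding column_sum_def by (intro sum.cong refl) (simp only: R.scale_zero_left split: if_split, simp)
  then show ?thesis using assms by (simp only: sum.delta if_True)
qed

lemma span_hcol:
  assumes "finite J"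
  shows "R.span (hcol s \<beta> A ` J) = column_sum s \<beta> A J ` free_mod J"
proof (intro R.span_subspace subsetI)
  fix x assume "x \<in> hcol s \<beta> A ` J"
  then obtain j where "j \<in> J" "x = hcol s \<beta> A j" by blast
  then show "x \<in> column_sum s \<beta> A J ` free_mod J"
    using column_sum_unit[OF assms, of j s \<beta> A 1]
    by (intro image_eqI[of _ _ "\<lambda>i. if i = j then 1 else 0"]) (simp_all add: free_mod_def)
next
  fix x assume "x \<in> column_sum s \<beta> A J ` free_mod J"
  then show "x \<in> R.span (hcol s \<beta> A ` J)"
    unfolding column_sum_def by (elim imageE) (simp only:, intro R.span_sum R.span_scale R.span_base imageI)
next
  show "R.subspace (column_sum s \<beta> A J ` free_mod J)"
    unfolding R.subspace_def
  proof (intro conjI ballI allI)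
    show "0 \<in> column_sum s \<beta> A J ` free_mod J"
      by (intro image_eqI[of _ _ 0]) (simp_all only: column_sum_zero, simp add: free_mod_def)
  next
    fix x y assume "x \<in> column_sum s \<beta> A J ` free_mod J" "y \<in> column_sum s \<beta> A J ` free_mod J"
    then obtain f g where "x = column_sum s \<beta> A J f" "y = column_sum s \<beta> A J g"
      "f \<in> free_mod J" "g \<in> free_mod J" by blast
    then show "x + y \<in> column_sum s \<beta> A J ` free_mod J"
      by (intro image_eqI[of _ _ "f + g"]) (simp_all only: column_sum_add, simp add: free_mod_def)
  next
    fix p x assume "x \<in> column_sum s \<beta> A J ` free_mod J"
    then obtain f where "x = column_sum s \<beta> A J f" "f \<in> free_mod J" by blast
    then show "pscale p x \<in> column_sum s \<beta> A J ` free_mod J"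
      by (intro image_eqI[of _ _ "pscale p f"])
        (simp_all only: column_sum_scale, simp add: free_mod_def pscale_apply)
  qed
qed

lemma homogeneous_column_sum:
  assumes "homogeneous (\<lambda>j. mon_of (\<beta> j)) m f"
  shows "homogeneous (\<lambda>_. 0) m (column_sum s \<beta> A J f)"
  unfolding column_sum_def
proof (rule homogeneous_sum)
  fix j
  show "homogeneous (\<lambda>_. 0) m (pscale (f j) (hcol s \<beta> A j))"
  proof (cases "f j = 0")
    case False
    then have dvd: "mon_dvd (mon_of (\<beta> j)) m" by (rule homogeneous_mon_dvd[OF assms])
    then have "f j = single (m - mon_of (\<beta> j)) (lookup (f j) (m - mon_of (\<beta> j)))"
      using homogeneous_entry[OF assms, of j] by simp
    then show ?thesis
      using homogeneous_scale_single[OF homogeneous_hcol[of \<beta> j s A] dvd] by metis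
  qed (simp only: R.scale_zero_left homogeneous_zero)
qed

lemma component_column_sum:
  "column_sum s \<beta> A J (component (\<lambda>j. mon_of (\<beta> j)) m f)
     = component (\<lambda>_. 0) m (column_sum s \<beta> A J f)"
proof -
  have "component (\<lambda>_. 0) m (\<Sum>j\<in>J. g j) = (\<Sum>j\<in>J. component (\<lambda>_. 0) m (g j))"
    for g :: "nat \<Rightarrow> ('a, 'b) vec"
    by (induction J rule: infinite_finite_induct)
       (simp_all only: sum.infinite sum.empty component_zero sum.insert component_add
         not_False_eq_True)
  moreover have "pscale (component (\<lambda>j. mon_of (\<beta> j)) m f j) (hcol s \<beta> A j)
      = component (\<lambda>_. 0) m (pscale (f j) (hcol s \<beta> A j))" for j
    unfolding component_scale[OF homogeneous_hcol] component_def[of "\<lambda>j. mon_of (\<beta> j)"]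
    by (simp only: R.scale_zero_left split: if_split) simp
  ultimately show ?thesis
    unfolding column_sum_def by (simp only:)
qed

text \<open>On the \<open>i\<close>-th summand this is the map \<open>R \<rightarrow> E(k)\<close> with \<open>1 \<mapsto> X\<^bsup>-\<alpha> i\<^esup>\<close>. A monomial
  \<open>X\<^sup>a\<close> goes to \<open>X\<^bsup>a - \<alpha> i\<^esup>\<close>, or to \<open>0\<close> if \<open>a \<le> \<alpha> i\<close> fails; so the kernel is spanned by the
  monomials of \<open>U\<close>, and \<open>R\<^sup>s/U\<close> embeds into the cofree module. If \<open>\<alpha> i\<close> has a negative
  entry, all of \<open>R e\<^sub>i\<close> lies in \<open>U\<close> and the map has to be \<open>0\<close> there.\<close>

definition cofree_embedding ::
  "nat \<Rightarrow> (nat \<Rightarrow> 'v::finite deg) \<Rightarrow> ('v, 'k::field) vec \<Rightarrow> ('v, 'k) vec" where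
  "cofree_embedding s \<alpha> v =
     (\<lambda>i. if i < s \<and> 0 \<le> \<alpha> i then contr (v i) (single (mon_of (\<alpha> i)) 1) else 0)"

lemma lookup_cofree_embedding:
  "lookup (cofree_embedding s \<alpha> v i) x =
     (if i < s \<and> deg_of x \<le> \<alpha> i then lookup (v i) (mon_of (\<alpha> i) - x) else 0)"
proof -
  have "0 \<le> \<alpha> i \<and> mon_dvd x (mon_of (\<alpha> i)) \<longleftrightarrow> deg_of x \<le> \<alpha> i"
    using deg_of_nonneg[of x] deg_of_mon_of[of "\<alpha> i"] order_trans[of 0 "deg_of x" "\<alpha> i"]
    by (auto simp: mon_dvd_iff_deg)
  then show ?thesis by (auto simp: cofree_embedding_def lookup_contr_single)
qed

lemma cofree_embedding_add:
  "cofree_embedding s \<alpha> (v + w) = cofree_embedding s \<alpha> v + cofree_embedding s \<alpha> w"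
  by (auto intro!: ext poly_mapping_eqI simp: lookup_cofree_embedding lookup_add)

lemma cofree_embedding_diff:
  "cofree_embedding s \<alpha> (v - w) = cofree_embedding s \<alpha> v - cofree_embedding s \<alpha> w"
  by (auto intro!: ext poly_mapping_eqI simp: lookup_cofree_embedding lookup_minus)

lemma cofree_embedding_eq_0_iff:
  assumes "\<And>i. s \<le> i \<Longrightarrow> v i = 0"
  shows "cofree_embedding s \<alpha> v = 0 \<longleftrightarrow> v \<in> Umod s \<alpha>"
proof
  assume eq: "cofree_embedding s \<alpha> v = 0"
  have "i < s \<and> \<not> deg_of a \<le> \<alpha> i" if "lookup (v i) a \<noteq> 0" for i a
  proof -
    have "i < s" using that assms[of i] by (cases "i < s") auto
    moreover have False if le: "deg_of a \<le> \<alpha> i"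
    proof -
      have *: "0 \<le> \<alpha> i" using deg_of_nonneg[of a] le by (rule order_trans)
      then have dvd: "mon_dvd a (mon_of (\<alpha> i))" using le by (simp add: mon_dvd_iff_deg deg_of_mon_of)
      let ?x = "mon_of (\<alpha> i) - a"
      have "deg_of ?x \<le> deg_of (mon_of (\<alpha> i))"
        using mon_diff_dvd[OF dvd] by (simp add: mon_dvd_iff_deg)
      then have "lookup (cofree_embedding s \<alpha> v i) ?x = lookup (v i) a"
        using \<open>i < s\<close> * mon_diff_diff[OF dvd] by (simp add: lookup_cofree_embedding deg_of_mon_of)
      then show False using eq \<open>lookup (v i) a \<noteq> 0\<close> by simp
    qed
    ultimately show ?thesis by blast
  qed
  then show "v \<in> Umod s \<alpha>"
    unfolding Umod_eq U_monomials_def by (auto simp: in_supp_iff)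
next
  assume v: "v \<in> Umod s \<alpha>"
  have "lookup (v i) (mon_of (\<alpha> i) - x) = 0" if "i < s" "deg_of x \<le> \<alpha> i" for i x
  proof -
    have *: "0 \<le> \<alpha> i" using deg_of_nonneg[of x] that(2) by (rule order_trans)
    then have dvd: "mon_dvd x (mon_of (\<alpha> i))" using that by (simp add: mon_dvd_iff_deg deg_of_mon_of)
    have "deg_of (mon_of (\<alpha> i) - x) \<le> \<alpha> i"
      using mon_diff_dvd[OF dvd] * by (simp add: mon_dvd_iff_deg deg_of_mon_of)
    then have "(i, mon_of (\<alpha> i) - x) \<notin> supp v"
      using v unfolding Umod_eq U_monomials_def by blast
    then show ?thesis by (simp add: in_supp_iff)
  qed
  then show "cofree_embedding s \<alpha> v = 0"
    by (auto intro!: ext poly_mapping_eqI simp: lookup_cofree_embedding)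
qed

lemma column_sum_bounded: "s \<le> i \<Longrightarrow> column_sum s \<beta> A J f i = 0"
  by (simp add: column_sum_def sum_fun_apply pscale_apply hcol_def)

lemma lookup_phi:
  fixes A :: "nat \<Rightarrow> nat \<Rightarrow> 'k::field" and \<beta> :: "nat \<Rightarrow> 'v::finite deg"
  shows "lookup (phi s \<alpha> J \<beta> A f i) x = (if i < s then
     \<Sum>j\<in>J. if mon_dvd x (mon_of (\<alpha> i - \<beta> j)) then lookup (f j) (mon_of (\<alpha> i - \<beta> j) - x) * A i j else 0
     else 0)"
proof -
  have "lookup (phi s \<alpha> J \<beta> A f i) x = (\<Sum>j\<in>J. lookup (contr (f j)
      (if i < s then single (mon_of (\<alpha> i - \<beta> j)) (A i j) else 0)) x)"
    by (simp add: phi_def sum_fun_apply lookup_sum escale_def)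
  moreover have "contr p 0 = 0" for p :: "('v, 'k) mpoly"
    by (simp add: contr_def)
  ultimately show ?thesis by (simp add: lookup_contr_single)
qed

text \<open>Both sides collect the same coefficients. The column \<open>j\<close> enters the degree \<open>\<alpha> i - x\<close> of the
  \<open>i\<close>-th summand through the coefficient of \<open>f\<^sub>j\<close> at \<open>\<alpha> i - \<beta> j - x\<close>, and this is the
  difference of \<open>\<alpha> i - \<delta> - x\<close> and \<open>\<beta> j - \<delta>\<close>. The bound \<open>\<delta> \<le> \<beta> j\<close> ensures that no exponent
  is truncated.\<close>

lemma phi_eq_cofree_embedding:
  assumes fc: "fc_matrix s \<alpha> J \<beta> A"
    and \<delta>: "\<And>i j. i < s \<Longrightarrow> j \<in> J \<Longrightarrow> A i j \<noteq> 0 \<Longrightarrow> \<delta> \<le> \<beta> j"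
  shows "phi s \<alpha> J \<beta> A f
    = cofree_embedding s (\<lambda>i. \<alpha> i - \<delta>) (column_sum s (\<lambda>j. \<beta> j - \<delta>) A J f)"
proof (rule ext, rule poly_mapping_eqI)
  fix i x
  show "lookup (phi s \<alpha> J \<beta> A f i) x = lookup
    (cofree_embedding s (\<lambda>i. \<alpha> i - \<delta>) (column_sum s (\<lambda>j. \<beta> j - \<delta>) A J f) i) x"
  proof (cases "i < s")
    case False
    then show ?thesis by (simp add: lookup_phi lookup_cofree_embedding)
  next
    case i: True
    let ?y = "mon_of (\<alpha> i - \<delta>) - x"
    have "(if mon_dvd x (mon_of (\<alpha> i - \<beta> j))
            then lookup (f j) (mon_of (\<alpha> i - \<beta> j) - x) * A i j else 0)
        = (if deg_of x \<le> \<alpha> i - \<delta> then lookup (f j * single (mon_of (\<beta> j - \<delta>)) (A i j)) ?y else 0)"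
      if j: "j \<in> J" for j
    proof (cases "A i j = 0")
      case False
      have le: "\<delta> \<le> \<beta> j" "\<beta> j \<le> \<alpha> i"
        using \<delta>[OF i j False] fc i j False unfolding fc_matrix_def by auto
      have pw: "\<delta> k \<le> \<beta> j k" "\<beta> j k \<le> \<alpha> i k" for k using le by (auto simp: le_fun_def)
      have dvd: "mon_dvd x (mon_of (\<alpha> i - \<beta> j)) \<longleftrightarrow>
          deg_of x \<le> \<alpha> i - \<delta> \<and> mon_dvd (mon_of (\<beta> j - \<delta>)) ?y"
      proof -
        have "lookup x k \<le> nat (\<alpha> i k - \<beta> j k) \<longleftrightarrow> int (lookup x k) \<le> \<alpha> i k - \<delta> k \<and>
            nat (\<beta> j k - \<delta> k) \<le> nat (\<alpha> i k - \<delta> k) - lookup x k" for k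
          using pw[of k] by arith
        then show ?thesis
          by (auto simp: mon_dvd_iff deg_of_def le_fun_def lookup_minus)
      qed
      have "mon_of (\<alpha> i - \<beta> j) - x = ?y - mon_of (\<beta> j - \<delta>)"
      proof (rule poly_mapping_eqI)
        fix k
        show "lookup (mon_of (\<alpha> i - \<beta> j) - x) k = lookup (?y - mon_of (\<beta> j - \<delta>)) k"
          using pw[of k] by (simp add: lookup_minus)
      qed
      then show ?thesis using dvd by (auto simp: lookup_times_single)
    qed simp
    then show ?thesis using i
      by (auto simp: lookup_phi lookup_cofree_embedding column_sum_def sum_fun_apply lookup_sum
          pscale_apply hcol_def cong: sum.cong)
  qed
qed

lemma phi_image_eq:
  assumes "fc_matrix s \<alpha> J \<beta> A"
    and "\<And>i j. i < s \<Longrightarrow> j \<in> J \<Longrightarrow> A i j \<noteq> 0 \<Longrightarrow> \<delta> \<le> \<beta> j"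
  shows "phi_image s \<alpha> J \<beta> A = cofree_embedding s (\<lambda>i. \<alpha> i - \<delta>) `
     Vmod s (\<lambda>i. \<alpha> i - \<delta>) J (\<lambda>j. \<beta> j - \<delta>) A"
proof -
  let ?\<alpha> = "\<lambda>i. \<alpha> i - \<delta>" and ?\<beta> = "\<lambda>j. \<beta> j - \<delta>"
  have fin: "finite J" using assms(1) by (simp add: fc_matrix_def)
  have "u \<in> cofree_embedding s ?\<alpha> ` R.span (hcol s ?\<beta> A ` J)"
    if u: "u \<in> cofree_embedding s ?\<alpha> ` Vmod s ?\<alpha> J ?\<beta> A" for u
  proof -
    obtain x y where xy: "x \<in> R.span (hcol s ?\<beta> A ` J)" "y \<in> Umod s ?\<alpha>"
      "u = cofree_embedding s ?\<alpha> (x + y)"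
      using u unfolding Vmod_def by blast
    have "cofree_embedding s ?\<alpha> y = 0"
      using xy(2) Umod_subset_Vmod Vmod_bounded by (subst cofree_embedding_eq_0_iff) blast+
    then show ?thesis using xy by (simp add: cofree_embedding_add)
  qed
  moreover have "R.span (hcol s ?\<beta> A ` J) \<subseteq> Vmod s ?\<alpha> J ?\<beta> A"
    unfolding Vmod_eq_span by (intro R.span_mono) blast
  ultimately have "cofree_embedding s ?\<alpha> ` Vmod s ?\<alpha> J ?\<beta> A
      = cofree_embedding s ?\<alpha> ` R.span (hcol s ?\<beta> A ` J)" by blast
  moreover have "phi_image s \<alpha> J \<beta> A
      = (\<lambda>f. cofree_embedding s ?\<alpha> (column_sum s ?\<beta> A J f)) ` free_mod J"
    unfolding phi_image_def by (intro image_cong refl phi_eq_cofree_embedding[OF assms])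
  ultimately show ?thesis by (simp only: span_hcol[OF fin] image_image)
qed

text \<open>The image of the \<open>j\<close>-th basis element has degree \<open>\<beta> j\<close> and is not zero. This is how the
  degrees of non-zero columns are bounded by the support of the module.\<close>

lemma column_degree_in_image:
  fixes A :: "nat \<Rightarrow> nat \<Rightarrow> 'k::field" and \<beta> :: "nat \<Rightarrow> 'v::finite deg"
  assumes fc: "fc_matrix s \<alpha> J \<beta> A" and "i < s" "j \<in> J" "A i j \<noteq> 0"
  shows "phi_image s \<alpha> J \<beta> A \<inter> cofree_comp s \<alpha> (\<beta> j) \<noteq> {0}"
proof -
  have fin: "finite J" and le: "\<And>i. i < s \<Longrightarrow> A i j \<noteq> 0 \<Longrightarrow> \<beta> j \<le> \<alpha> i"
    using fc \<open>j \<in> J\<close> unfolding fc_matrix_def by auto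
  let ?e = "\<lambda>l. if l = j then 1 else 0 :: ('v, 'k) mpoly"
  have eq: "lookup (phi s \<alpha> J \<beta> A ?e i) x = (if i < s \<and> x = mon_of (\<alpha> i - \<beta> j) then A i j else 0)"
    for i x
  proof (cases "i < s")
    case True
    have iff: "mon_dvd x m \<and> m - x = 0 \<longleftrightarrow> x = m" for m
      using mon_add_diff[of x m] by auto
    have "lookup (phi s \<alpha> J \<beta> A ?e i) x = (\<Sum>l\<in>J. if l = j then
       if mon_dvd x (mon_of (\<alpha> i - \<beta> j)) \<and> mon_of (\<alpha> i - \<beta> j) - x = 0
       then A i j else 0 else 0)"
      unfolding lookup_phi if_P[OF True]
      by (intro sum.cong refl) (auto simp: lookup_one when_def)
    then show ?thesis unfolding iff using fin \<open>j \<in> J\<close> True by simp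
  qed (simp add: lookup_phi)
  have "phi s \<alpha> J \<beta> A ?e \<in> phi_image s \<alpha> J \<beta> A"
    unfolding phi_image_def using \<open>j \<in> J\<close> by (intro imageI) (auto simp: free_mod_def)
  moreover have "phi s \<alpha> J \<beta> A ?e \<in> cofree_comp s \<alpha> (\<beta> j)"
    unfolding cofree_comp_def
  proof (intro CollectI conjI allI impI ballI)
    fix i assume "s \<le> i"
    then show "phi s \<alpha> J \<beta> A ?e i = 0" by (intro poly_mapping_eqI) (simp add: eq)
  next
    fix i x assume "x \<in> keys (phi s \<alpha> J \<beta> A ?e i)"
    then have "i < s" "x = mon_of (\<alpha> i - \<beta> j)" "A i j \<noteq> 0"
      by (auto simp: in_keys_iff eq split: if_splits)
    then show "\<alpha> i - deg_of x = \<beta> j"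
      using le[of i] by (simp add: deg_of_mon_of)
  qed
  moreover have "phi s \<alpha> J \<beta> A ?e \<noteq> 0"
    using eq[of i "mon_of (\<alpha> i - \<beta> j)"] assms by auto
  ultimately show ?thesis by blast
qed

lemma cofree_embedding_degree:
  assumes "homogeneous (\<lambda>_. 0) a v"
  shows "cofree_embedding s (\<lambda>i. \<alpha> i - \<delta>) v \<in> cofree_comp s \<alpha> (deg_of a + \<delta>)"
  unfolding cofree_comp_def
proof (intro CollectI conjI allI impI ballI)
  fix i assume "s \<le> i"
  then show "cofree_embedding s (\<lambda>i. \<alpha> i - \<delta>) v i = 0"
    by (simp add: cofree_embedding_def)
next
  fix i x assume "x \<in> keys (cofree_embedding s (\<lambda>i. \<alpha> i - \<delta>) v i)"
  then have x: "deg_of x \<le> \<alpha> i - \<delta>" "lookup (v i) (mon_of (\<alpha> i - \<delta>) - x) \<noteq> 0"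
    by (auto simp: in_keys_iff lookup_cofree_embedding split: if_splits)
  have *: "0 \<le> \<alpha> i - \<delta>" using deg_of_nonneg[of x] x(1) by (rule order_trans)
  then have dvd: "mon_dvd x (mon_of (\<alpha> i - \<delta>))" using x(1) by (simp add: mon_dvd_iff_deg deg_of_mon_of)
  have "mon_of (\<alpha> i - \<delta>) - x = a"
    using assms x(2) by (auto simp: homogeneous_def in_keys_iff)
  then have "deg_of a = \<alpha> i - \<delta> - deg_of x"
    using deg_of_diff[OF dvd] deg_of_mon_of[OF *] by simp
  then show "\<alpha> i - deg_of x = deg_of a + \<delta>" by simp
qed


section \<open>Groebner form and its existence\<close>

context position_order
begin

lemma lead_monomials_Umod:
  "lead_monomials (Umod s \<alpha> :: ('v, 'k::field) vec set) = U_monomials s \<alpha>"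
proof (intro equalityI subsetI)
  fix m assume "m \<in> lead_monomials (Umod s \<alpha> :: ('v, 'k) vec set)"
  then obtain w :: "('v, 'k) vec" where w: "w \<in> Umod s \<alpha>" "w \<noteq> 0" "m = lm ord w"
    unfolding lead_monomials_def by blast
  have "supp w \<subseteq> U_monomials s \<alpha>" using w(1) by (simp add: Umod_eq)
  moreover have "U_monomials s \<alpha> \<subseteq> {..<s} \<times> UNIV" by (auto simp: U_monomials_def)
  ultimately show "m \<in> U_monomials s \<alpha>"
    unfolding w(3) using lm_in_supp[OF w(2)] by blast
next
  fix m assume m: "m \<in> U_monomials s \<alpha>"
  let ?w = "mvec m :: ('v, 'k) vec"
  have "lm ord ?w \<in> supp ?w"
    using m by (intro lm_in_supp) (auto simp: U_monomials_def)
  then have "lm ord ?w = m" by simp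
  moreover have "?w \<in> Umod s \<alpha>" using m by (simp add: Umod_eq)
  ultimately show "m \<in> lead_monomials (Umod s \<alpha> :: ('v, 'k) vec set)"
    unfolding lead_monomials_def by (intro CollectI exI[of _ ?w]) simp
qed

text \<open>Each of the three spans in the definition consists of all vectors supported in some set of
  monomials, so the equation between spans is one between sets of monomials.\<close>

lemma groebner_form_iff:
  fixes A :: "nat \<Rightarrow> nat \<Rightarrow> 'k::field"
  shows "groebner_form ord s \<alpha> J \<beta> A \<longleftrightarrow>
    (\<forall>j\<in>J. hcol s \<beta> A j \<notin> Umod s \<alpha> \<and> supp (hcol s \<beta> A j) \<inter> U_monomials s \<alpha> = {}) \<and>
    multiples ((\<lambda>j. lm ord (hcol s \<beta> A j)) ` J) \<union> U_monomials s \<alpha>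
      = lead_monomials (Vmod s \<alpha> J \<beta> A)"
proof -
  let ?U = "Umod s \<alpha> :: ('v, 'k) vec set" and ?V = "Vmod s \<alpha> J \<beta> A"
  let ?L = "(\<lambda>j. lm ord (hcol s \<beta> A j)) ` J" and ?Q = "U_monomials s \<alpha>"
  have bound: "supp w \<subseteq> {..<s} \<times> UNIV" if "w \<in> ?V" for w
    using Vmod_bounded[OF that] by (simp add: supp_bounded_iff)
  have U: "lm_span ord ?U = {v. supp v \<subseteq> ?Q}"
    using bound Umod_subset_Vmod[of s \<alpha> J \<beta> A]
    by (subst lm_span_eq) (auto simp only: lead_monomials_Umod)
  have V: "lm_span ord ?V = {v. supp v \<subseteq> lead_monomials ?V}"
    by (rule lm_span_eq[OF bound])
  have V_sub: "lead_monomials ?V \<subseteq> {..<s} \<times> UNIV"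
    using bound lm_in_supp unfolding lead_monomials_def by blast
  have supp_eq_iff: "{v :: ('v, 'k) vec. supp v \<subseteq> S} = {v. supp v \<subseteq> T} \<longleftrightarrow> S = T" for S T
  proof
    assume "{v :: ('v, 'k) vec. supp v \<subseteq> S} = {v. supp v \<subseteq> T}"
    then have "supp (mvec m :: ('v, 'k) vec) \<subseteq> S \<longleftrightarrow> supp (mvec m :: ('v, 'k) vec) \<subseteq> T" for m
      by blast
    then show "S = T" by auto
  qed simp
  have third: "{x + y | x y. x \<in> R.span ((\<lambda>h. mvec (lm ord h)) ` hcol s \<beta> A ` J) \<and>
        y \<in> lm_span ord ?U} = lm_span ord ?V \<longleftrightarrow> multiples ?L \<union> ?Q = lead_monomials ?V"
    if nz: "\<forall>j\<in>J. hcol s \<beta> A j \<notin> ?U"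
  proof -
    have "?L \<subseteq> lead_monomials ?V"
    proof (rule image_subsetI)
      fix j assume j: "j \<in> J"
      then have "hcol s \<beta> A j \<noteq> 0" using nz R.subspace_0[OF subspace_Umod] by metis
      then show "lm ord (hcol s \<beta> A j) \<in> lead_monomials ?V"
        unfolding lead_monomials_def using hcol_in_Vmod[OF j] by blast
    qed
    then have L: "?L \<subseteq> {..<s} \<times> UNIV" using V_sub by blast
    then have mL: "multiples ?L \<subseteq> {..<s} \<times> UNIV" by (auto simp: multiples_def)
    have Q: "?Q \<subseteq> {..<s} \<times> UNIV" by (auto simp: U_monomials_def)
    have "R.span ((\<lambda>h. mvec (lm ord h)) ` hcol s \<beta> A ` J)
        = {v :: ('v, 'k) vec. supp v \<subseteq> multiples ?L}"
      using span_mvec_ring[OF L] by (simp only: image_image)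
    moreover have "{x + y | x y. x \<in> {v. supp v \<subseteq> multiples ?L} \<and> y \<in> {v. supp v \<subseteq> ?Q}}
        = {v :: ('v, 'k) vec. supp v \<subseteq> multiples ?L \<union> ?Q}"
    proof -
      let ?m = "\<lambda>S. mvec ` S :: ('v, 'k) vec set"
      have "K.span (?m (multiples ?L) \<union> ?m ?Q) = {v. supp v \<subseteq> multiples ?L \<union> ?Q}"
        unfolding image_Un[symmetric] using mL Q by (intro span_mvec_field) blast
      then show ?thesis
        unfolding K.span_Un span_mvec_field[OF mL] span_mvec_field[OF Q] .
    qed
    ultimately show ?thesis
      by (simp only: U V supp_eq_iff)
  qed
  have 1: "hcol s \<beta> A ` J \<subseteq> ?V - ?U \<longleftrightarrow> (\<forall>j\<in>J. hcol s \<beta> A j \<notin> ?U)"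
    using hcol_in_Vmod by blast
  have 2: "(\<forall>m\<in>supp (hcol s \<beta> A j). mvec m \<notin> lm_span ord ?U) \<longleftrightarrow>
      supp (hcol s \<beta> A j) \<inter> ?Q = {}" for j
    unfolding U by auto
  show ?thesis
  proof (cases "\<forall>j\<in>J. hcol s \<beta> A j \<notin> ?U")
    case True
    show ?thesis
      unfolding groebner_form_def 1 2 third[OF True] ball_conj_distrib conj_assoc ..
  next
    case False
    show ?thesis
      unfolding groebner_form_def 1 ball_conj_distrib by (simp only: False simp_thms)
  qed
qed

text \<open>A homogeneous element with leading monomial \<open>X\<^sup>a e\<^sub>i\<close> exists since \<open>V\<close> is graded. Deleting its
  terms in \<open>U\<close> keeps it in \<open>V\<close> and gives a column that satisfies the support condition of
  Groebner form.\<close>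

lemma graded_lift:
  fixes A :: "nat \<Rightarrow> nat \<Rightarrow> 'k::field"
  assumes "(i, a) \<in> lead_monomials (Vmod s \<alpha> J \<beta> A) - U_monomials s \<alpha>"
  shows "\<exists>c. (\<lambda>j. if j < s then single a (c j) else 0) \<in> Vmod s \<alpha> J \<beta> A \<and> i < s \<and> c i \<noteq> 0 \<and>
    (\<forall>j<s. c j \<noteq> 0 \<longrightarrow> deg_of a \<le> \<alpha> j \<and> (j = i \<or> rk j < rk i))"
proof -
  let ?V = "Vmod s \<alpha> J \<beta> A"
  have bound: "supp w \<subseteq> {..<s} \<times> UNIV" if "w \<in> ?V" for w
    using Vmod_bounded[OF that] by (simp add: supp_bounded_iff)
  obtain w where w: "w \<in> ?V" "homogeneous (\<lambda>_. 0) a w" "i < s" "w i \<noteq> 0"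
      "\<forall>j. w j \<noteq> 0 \<longrightarrow> j < s \<and> (j = i \<or> rk j < rk i)"
    using lead_monomial_homogeneous[where W = ?V, OF component_in_Vmod bound] assms by blast
  \<comment> \<open>the part of \<open>w\<close> outside \<open>U\<close>\<close>
  define c where "c j = (if deg_of a \<le> \<alpha> j then lookup (w j) a else 0)" for j
  let ?u = "\<lambda>j. if j < s then single a (c j) else 0"
  have wj: "w j = single a (lookup (w j) a)" for j
    using homogeneous_entry[OF w(2), of j] by (simp add: mon_dvd_iff)
  have "homogeneous (\<lambda>_. 0) a ?u" by (auto simp: homogeneous_def split: if_splits)
  then have "w - ?u \<in> Umod s \<alpha>"
    using w(2) w(5) wj
    by (subst homogeneous_in_Umod_iff[OF homogeneous_diff]) (auto simp: c_def)
  then have "w - (w - ?u) \<in> ?V"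
    using w(1) Umod_subset_Vmod subspace_Vmod R.subspace_diff by blast
  then have "?u \<in> ?V" by (simp only: diff_diff_eq2 add_diff_cancel_left')
  moreover have "deg_of a \<le> \<alpha> i" using assms w(3) by (auto simp: U_monomials_def)
  then have "c i \<noteq> 0" using wj[of i] w(4) unfolding c_def by (metis Poly_Mapping.single_zero)
  moreover have "deg_of a \<le> \<alpha> j \<and> (j = i \<or> rk j < rk i)" if "c j \<noteq> 0" for j
    using that w(5)[rule_format, of j] unfolding c_def by (cases "w j = 0") (auto split: if_splits)
  ultimately show ?thesis using w(3) by blast
qed

text \<open>In place of a run of Buchberger's algorithm, one column is appended for every leading
  monomial of \<open>V\<close> outside \<open>lm(U)\<close>.\<close>

lemma groebner_completion_exists:
  fixes A :: "nat \<Rightarrow> nat \<Rightarrow> 'k::field"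
  assumes fc: "fc_matrix s \<alpha> {..<t} \<beta> A"
    and fin: "finite {\<gamma>. phi_image s \<alpha> {..<t} \<beta> A \<inter> cofree_comp s \<alpha> \<gamma> \<noteq> {0}}"
    and ge: "\<And>\<gamma>. phi_image s \<alpha> {..<t} \<beta> A \<inter> cofree_comp s \<alpha> \<gamma> \<noteq> {0} \<Longrightarrow> \<delta> \<le> \<gamma>"
  shows "\<exists>J \<beta>' A'. groebner_completion ord \<delta> s \<alpha> t \<beta> A J \<beta>' A'"
proof -
  let ?\<alpha> = "\<lambda>i. \<alpha> i - \<delta>" and ?\<beta> = "\<lambda>j. \<beta> j - \<delta>"
  let ?V = "Vmod s ?\<alpha> {..<t} ?\<beta> A" and ?Q = "U_monomials s ?\<alpha>"
  let ?M = "phi_image s \<alpha> {..<t} \<beta> A"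
  define T where "T = lead_monomials ?V - ?Q"
  have \<delta>: "\<delta> \<le> \<beta> j" if "i < s" "j < t" "A i j \<noteq> 0" for i j
    using column_degree_in_image[OF fc] that ge by blast
  have image: "?M = cofree_embedding s ?\<alpha> ` ?V"
    using \<delta> by (intro phi_image_eq[OF fc]) auto
  have "\<forall>m. \<exists>c. m \<in> T \<longrightarrow>
      (\<lambda>j. if j < s then single (snd m) (c j) else 0) \<in> ?V \<and> fst m < s \<and> c (fst m) \<noteq> 0 \<and>
      (\<forall>j<s. c j \<noteq> 0 \<longrightarrow> deg_of (snd m) \<le> ?\<alpha> j \<and> (j = fst m \<or> rk j < rk (fst m)))"
  proof
    fix m
    have "m \<in> T \<Longrightarrow> (fst m, snd m) \<in> lead_monomials ?V - ?Q" by (simp add: T_def)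
    from graded_lift[OF this] show "\<exists>c. m \<in> T \<longrightarrow>
      (\<lambda>j. if j < s then single (snd m) (c j) else 0) \<in> ?V \<and> fst m < s \<and> c (fst m) \<noteq> 0 \<and>
      (\<forall>j<s. c j \<noteq> 0 \<longrightarrow> deg_of (snd m) \<le> ?\<alpha> j \<and> (j = fst m \<or> rk j < rk (fst m)))"
      by blast
  qed
  from choice[OF this] obtain c where c: "\<And>m. m \<in> T \<Longrightarrow>
      (\<lambda>j. if j < s then single (snd m) (c m j) else 0) \<in> ?V \<and> fst m < s \<and> c m (fst m) \<noteq> 0 \<and>
      (\<forall>j<s. c m j \<noteq> 0 \<longrightarrow> deg_of (snd m) \<le> ?\<alpha> j \<and> (j = fst m \<or> rk j < rk (fst m)))"
    by (elim exE) blast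
  define u where "u m = (\<lambda>j. if j < s then single (snd m) (c m j) else 0)" for m
  have u_hom: "homogeneous (\<lambda>_. 0) (snd m) (u m)" for m
    by (auto simp: homogeneous_def u_def split: if_splits)
  have u_V: "u m \<in> ?V" if "m \<in> T" for m using c[OF that] by (simp add: u_def)
  have u_lm: "lm ord (u m) = m" if "m \<in> T" for m
  proof -
    have "lm ord (u m) = (fst m, snd m)"
      using c[OF that] by (intro lm_homogeneous_eqI[OF u_hom]) (auto simp: u_def split: if_splits)
    then show ?thesis by simp
  qed
  have u_supp: "supp (u m) \<inter> ?Q = {}" if "m \<in> T" for m
    using c[OF that] by (auto simp: u_def U_monomials_def supp_def split: if_splits)
  have u_nonzero: "u m \<noteq> 0" if "m \<in> T" for m
  proof -
    have "u m (fst m) \<noteq> 0" using c[OF that] by (simp add: u_def)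
    then show ?thesis by auto
  qed
  have u_U: "u m \<notin> Umod s ?\<alpha>" if "m \<in> T" for m
    using u_supp[OF that] u_nonzero[OF that] by (auto simp: Umod_eq supp_empty_iff Int_absorb2)
  have degree: "?M \<inter> cofree_comp s \<alpha> (deg_of (snd m) + \<delta>) \<noteq> {0}" if "m \<in> T" for m
  proof -
    have "cofree_embedding s ?\<alpha> (u m) \<in> ?M" using u_V[OF that] image by blast
    moreover have "cofree_embedding s ?\<alpha> (u m) \<noteq> 0"
      using u_U[OF that] Vmod_bounded[OF u_V[OF that]]
      by (subst cofree_embedding_eq_0_iff) auto
    ultimately show ?thesis using cofree_embedding_degree[OF u_hom] by blast
  qed
  \<comment> \<open>a monomial in \<open>T\<close> is determined by its position and its degree, and the degree
    lies in the support of the image\<close>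
  have "finite T"
  proof (rule finite_imageD)
    let ?f = "\<lambda>m. (fst m, deg_of (snd m) + \<delta>)"
    have "?f ` T \<subseteq> {..<s} \<times> {\<gamma>. ?M \<inter> cofree_comp s \<alpha> \<gamma> \<noteq> {0}}"
      using degree c by auto
    then show "finite (?f ` T)" by (rule finite_subset[OF _ finite_cartesian_product[OF finite_lessThan fin]])
    show "inj_on ?f T" by (auto simp: inj_on_def deg_of_inject)
  qed
  then obtain e where e: "bij_betw e {..<card T} T"
    using ex_bij_betw_nat_finite by (metis atLeast0LessThan)
  define t' where "t' = t + card T"
  define J where "J = {j. j < t \<and> (\<exists>i<s. A i j \<noteq> 0)} \<union> {t..<t'}"
  define \<beta>' where "\<beta>' j = (if j < t then \<beta> j else deg_of (snd (e (j - t))) + \<delta>)" for j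
  define A' where "A' i j = (if j < t then A i j else c (e (j - t)) i)" for i j
  let ?\<beta>' = "\<lambda>j. \<beta>' j - \<delta>"
  have new: "e (j - t) \<in> T" if "j \<in> J" "\<not> j < t" for j
    using that e unfolding J_def t'_def by (auto simp: bij_betw_def)
  have finJ: "finite J" by (simp add: J_def)
  have h_old: "hcol s ?\<beta>' A' j = hcol s ?\<beta> A j" if "j < t" for j
    using that by (simp add: hcol_def \<beta>'_def A'_def cong: if_cong)
  have h_new: "hcol s ?\<beta>' A' j = u (e (j - t))" if "\<not> j < t" for j
    using that by (simp add: hcol_def \<beta>'_def A'_def u_def cong: if_cong)
  have fc': "fc_matrix s \<alpha> J \<beta>' A'"
    unfolding fc_matrix_def
  proof (intro conjI allI impI ballI)
    fix i j assume *: "i < s" "j \<in> J" "\<not> \<beta>' j \<le> \<alpha> i"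
    show "A' i j = 0"
    proof (cases "j < t")
      case True
      then show ?thesis using fc * by (simp add: fc_matrix_def A'_def \<beta>'_def)
    next
      case False
      then have "\<not> deg_of (snd (e (j - t))) \<le> \<alpha> i - \<delta>"
        using *(3) by (simp add: \<beta>'_def le_diff_eq)
      then show ?thesis using c[OF new[OF *(2) False]] *(1) False by (auto simp: A'_def)
    qed
  qed (rule finJ)
  have \<delta>': "\<delta> \<le> \<beta>' j" if "i < s" "j \<in> J" "A' i j \<noteq> 0" for i j
    using that \<delta>[of i j] deg_of_nonneg[of "snd (e (j - t))"] by (auto simp: \<beta>'_def A'_def)
  have V': "Vmod s ?\<alpha> J ?\<beta>' A' = ?V"
  proof (rule antisym)
    have "hcol s ?\<beta>' A' j \<in> ?V" if "j \<in> J" for j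
      using h_old[of j] h_new[of j] u_V[OF new[OF that]] hcol_in_Vmod[of j "{..<t}" s ?\<beta> A ?\<alpha>]
      by (cases "j < t") auto
    moreover have "{gE ?\<alpha> i k | i k. i < s} \<subseteq> ?V"
      unfolding Vmod_eq_span by (rule order_trans[OF _ R.span_superset]) blast
    ultimately show "Vmod s ?\<alpha> J ?\<beta>' A' \<subseteq> ?V"
      unfolding Vmod_eq_span[of s ?\<alpha> J] by (intro R.span_minimal subspace_Vmod) blast
    have "hcol s ?\<beta> A j \<in> Vmod s ?\<alpha> J ?\<beta>' A'" if j: "j < t" for j
    proof (cases "j \<in> J")
      case True
      then show ?thesis using hcol_in_Vmod[OF True, of s ?\<beta>' A'] h_old[OF j] by (simp only:)
    next
      case False
      then have "hcol s ?\<beta> A j = 0" using j by (auto simp: J_def hcol_def fun_eq_iff)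
      then show ?thesis using R.subspace_0[OF subspace_Vmod] by (simp only:)
    qed
    moreover have "{gE ?\<alpha> i k | i k. i < s} \<subseteq> Vmod s ?\<alpha> J ?\<beta>' A'"
      unfolding Vmod_eq_span by (rule order_trans[OF _ R.span_superset]) blast
    ultimately show "?V \<subseteq> Vmod s ?\<alpha> J ?\<beta>' A'"
      unfolding Vmod_eq_span[of s ?\<alpha> "{..<t}"] by (intro R.span_minimal subspace_Vmod) blast
  qed
  have "phi_image s \<alpha> J \<beta>' A' = cofree_embedding s ?\<alpha> ` Vmod s ?\<alpha> J ?\<beta>' A'"
    by (rule phi_image_eq[OF fc']) (rule \<delta>')
  then have "phi_image s \<alpha> J \<beta>' A' = ?M" by (simp only: image V')
  moreover have "groebner_form ord s ?\<alpha> J ?\<beta>' A'"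
    unfolding groebner_form_iff V'
  proof (intro conjI ballI)
    fix j assume j: "j \<in> J"
    have deg: "0 \<le> \<beta> j - \<delta> \<and> \<beta> j - \<delta> \<le> \<alpha> i - \<delta>" if "j < t" "i < s" "A i j \<noteq> 0" for i
    proof -
      have "\<beta> j \<le> \<alpha> i" using fc that by (auto simp: fc_matrix_def)
      then show ?thesis using \<delta>[of i j] that by (simp add: diff_right_mono)
    qed
    show "hcol s ?\<beta>' A' j \<notin> Umod s ?\<alpha>"
    proof (cases "j < t")
      case True
      then show ?thesis
        unfolding h_old[OF True] using j deg[OF True]
        by (subst hcol_in_Umod_iff) (auto simp: J_def t'_def)
    qed (use h_new[of j] u_U new[OF j] in simp)
    show "supp (hcol s ?\<beta>' A' j) \<inter> ?Q = {}"
    proof (cases "j < t")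
      case True
      then show ?thesis
        unfolding h_old[OF True] using deg[OF True]
        by (auto simp: hcol_def supp_def U_monomials_def deg_of_mon_of split: if_splits)
    qed (use h_new[of j] u_supp new[OF j] in simp)
  next
    let ?L = "(\<lambda>j. lm ord (hcol s ?\<beta>' A' j)) ` J"
    show "multiples ?L \<union> ?Q = lead_monomials ?V"
    proof (intro equalityI subsetI)
      fix m assume m: "m \<in> lead_monomials ?V"
      show "m \<in> multiples ?L \<union> ?Q"
      proof (cases "m \<in> ?Q")
        case False
        then have "m \<in> T" using m by (simp add: T_def)
        then have "m \<in> e ` {..<card T}" by (simp only: bij_betw_imp_surj_on[OF e])
        then obtain n where n: "n < card T" "e n = m" by (elim imageE) simp
        have "t + n \<in> J" using n by (simp add: J_def t'_def)
        moreover have "lm ord (hcol s ?\<beta>' A' (t + n)) = m"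
          using h_new[of "t + n"] n u_lm[OF \<open>m \<in> T\<close>] by simp
        ultimately have "m \<in> ?L" by (metis imageI)
        then show ?thesis
          unfolding multiples_def using mon_dvd_refl by (cases m) blast
      qed simp
    next
      fix m assume m: "m \<in> multiples ?L \<union> ?Q"
      show "m \<in> lead_monomials ?V"
      proof (cases "m \<in> ?Q")
        case True
        then show ?thesis
          using Umod_subset_Vmod lead_monomials_Umod unfolding lead_monomials_def by blast
      next
        case False
        obtain i a b j where m_eq: "m = (i, a)" and b: "mon_dvd b a" and j: "j \<in> J"
          and lm: "lm ord (hcol s ?\<beta>' A' j) = (i, b)"
          using m False unfolding multiples_def by auto
        let ?h = "hcol s ?\<beta>' A' j"
        have hV: "?h \<in> ?V" using hcol_in_Vmod[OF j, of s ?\<beta>' A' ?\<alpha>] unfolding V' .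
        have "?h \<noteq> 0"
        proof (cases "j < t")
          case True
          then obtain l where "l < s" "A l j \<noteq> 0" using j by (auto simp: J_def t'_def)
          then have "?h l \<noteq> 0" using True by (simp add: hcol_def A'_def)
          then show ?thesis by auto
        qed (use h_new[of j] u_nonzero new[OF j] in simp)
        then have "\<exists>l<s. lm ord ?h = (l, mon_of (?\<beta>' j)) \<and> ?h l \<noteq> 0 \<and>
            (\<forall>k. ?h k \<noteq> 0 \<longrightarrow> k < s \<and> (k = l \<or> rk k < rk l))"
          by (rule lm_homogeneous[OF homogeneous_hcol]) (simp add: hcol_def)
        then obtain l where l: "l < s" "lm ord ?h = (l, mon_of (?\<beta>' j))" "?h l \<noteq> 0"
          "\<forall>k. ?h k \<noteq> 0 \<longrightarrow> k < s \<and> (k = l \<or> rk k < rk l)"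
          by blast
        let ?v = "pscale (single (a - b) 1) ?h"
        have v: "?v k \<noteq> 0 \<longleftrightarrow> ?h k \<noteq> 0" for k
          by (simp add: pscale_apply hcol_def mult_single)
        have il: "i = l" using l(2) lm by simp
        have "homogeneous (\<lambda>_. 0) a ?v"
          using homogeneous_scale_single[OF homogeneous_hcol] b l(2) lm by simp
        then have "lm ord ?v = (l, a)"
        proof (rule lm_homogeneous_eqI[OF _ l(1)])
          show "?v l \<noteq> 0" using v l(3) by blast
          show "k < s \<and> (k = l \<or> rk k < rk l)" if "?v k \<noteq> 0" for k
            using v l(4) that by blast
        qed
        then have "lm ord ?v = m" unfolding m_eq il .
        moreover have "?v \<in> ?V" by (intro R.subspace_scale subspace_Vmod hV)
        moreover have "?v \<noteq> 0" using v[of l] l(3) by auto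
        ultimately show ?thesis unfolding lead_monomials_def by blast
      qed
    qed
  qed
  ultimately have "groebner_completion ord \<delta> s \<alpha> t \<beta> A J \<beta>' A'"
    unfolding groebner_completion_def using fc'
    by (intro conjI exI[of _ t']) (simp_all add: J_def \<beta>'_def A'_def t'_def)
  then show ?thesis by blast
qed

end


section \<open>Division with remainder zero\<close>

locale groebner_columns = position_order s ord rk lt
  for s :: nat and ord :: "nat \<times> 'v::finite mon \<Rightarrow> nat \<times> 'v mon \<Rightarrow> bool" and rk lt +
  fixes \<alpha> :: "nat \<Rightarrow> 'v deg" and J :: "nat set" and \<beta> :: "nat \<Rightarrow> 'v deg"
    and A :: "nat \<Rightarrow> nat \<Rightarrow> 'k::field"
  assumes finite_J: "finite J"
    and groebner: "groebner_form ord s \<alpha> J \<beta> A"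
begin

text \<open>\<open>source_deg\<close> and \<open>target_deg\<close> are the degrees of the basis elements of \<open>F\<^sub>0\<close> and of \<open>R\<^sup>s\<close>, in
  the form used by \<open>homogeneous\<close>.\<close>

abbreviation "U \<equiv> Umod s \<alpha> :: ('v, 'k) vec set"
abbreviation "V \<equiv> Vmod s \<alpha> J \<beta> A"
abbreviation "h \<equiv> hcol s \<beta> A"
abbreviation "g \<equiv> gen s \<alpha> \<beta> A"
abbreviation "index_set \<equiv> Inl ` J \<union> Inr ` ({..<s} \<times> (UNIV :: 'v set))"
abbreviation "source_deg \<equiv> \<lambda>j. mon_of (\<beta> j)"
abbreviation "target_deg \<equiv> \<lambda>_ :: nat. 0 :: 'v mon"
abbreviation "pos k \<equiv> fst (lm ord (g k))"
abbreviation "mon k \<equiv> snd (lm ord (g k))"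

lemma gen_simps [simp]: "g (Inl j) = h j" "g (Inr (i, k)) = gE \<alpha> i k"
  by (simp_all add: gen_def)

lemma h_nonzero: "j \<in> J \<Longrightarrow> h j \<noteq> 0"
  using groebner R.subspace_0[OF subspace_Umod] unfolding groebner_form_iff by metis

lemma lm_gE: "i < s \<Longrightarrow> lm ord (gE \<alpha> i k :: ('v, 'k) vec) = (i, single k (nat (\<alpha> i k + 1)))"
  unfolding gE_def
  by (rule lm_homogeneous_eqI[OF homogeneous_mvec[of "(i, _)", unfolded snd_conv]])
     (auto simp: mvec_def split: if_splits)

lemma gE_in_U: "i < s \<Longrightarrow> gE \<alpha> i k \<in> U"
  unfolding Umod_def by (intro R.span_base) blast

lemma
  assumes "k \<in> index_set"
  shows pos_less: "pos k < s"
    and homogeneous_gen: "homogeneous target_deg (mon k) (g k)"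
    and gen_pos_nonzero: "g k (pos k) \<noteq> 0"
    and gen_tail: "g k i \<noteq> 0 \<Longrightarrow> i < s \<and> (i = pos k \<or> rk i < rk (pos k))"
    and gen_in_V: "g k \<in> V"
proof -
  have "pos k < s \<and> homogeneous target_deg (mon k) (g k) \<and> g k (pos k) \<noteq> 0 \<and>
      (\<forall>i. g k i \<noteq> 0 \<longrightarrow> i < s \<and> (i = pos k \<or> rk i < rk (pos k))) \<and> g k \<in> V"
    using assms
  proof (elim UnE imageE)
    fix j assume k: "k = Inl j" "j \<in> J"
    have "\<exists>i<s. lm ord (h j) = (i, source_deg j) \<and> h j i \<noteq> 0 \<and>
        (\<forall>k. h j k \<noteq> 0 \<longrightarrow> k < s \<and> (k = i \<or> rk k < rk i))"
      by (rule lm_homogeneous[OF homogeneous_hcol h_nonzero[OF k(2)]]) (simp add: hcol_def)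
    then show ?thesis
      unfolding k using homogeneous_hcol[of \<beta> j s A] hcol_in_Vmod[OF k(2), of s \<beta> A \<alpha>] by auto
  next
    fix x assume k: "k = Inr x" "x \<in> {..<s} \<times> UNIV"
    obtain i l where x: "x = (i, l)" "i < s" using k by auto
    have "gE \<alpha> i l \<in> V"
      using gE_in_U[OF x(2)] by (rule subsetD[OF Umod_subset_Vmod])
    then show ?thesis
      using x homogeneous_mvec[of "(i, single l (nat (\<alpha> i l + 1)))"]
      unfolding k x gen_simps lm_gE[OF x(2)] by (auto simp: gE_def mvec_def split: if_splits)
  qed
  then show "pos k < s" "homogeneous target_deg (mon k) (g k)" "g k (pos k) \<noteq> 0"
    "g k i \<noteq> 0 \<Longrightarrow> i < s \<and> (i = pos k \<or> rk i < rk (pos k))" "g k \<in> V"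
    by blast+
qed

lemma mon_Inl: "j \<in> J \<Longrightarrow> mon (Inl j) = source_deg j"
  using lm_homogeneous[OF homogeneous_hcol h_nonzero, of j] by (auto simp: hcol_def)

lemma lc_gen_nonzero: "k \<in> index_set \<Longrightarrow> lc ord (g k) \<noteq> 0"
  using homogeneous_eq_0_iff[OF homogeneous_gen] gen_pos_nonzero by (simp add: lc_def)

lemma lookup_pscale_gen_pos:
  assumes "k \<in> index_set" "mon_dvd (mon k) m"
  shows "lookup (pscale (single (m - mon k) (c / lc ord (g k))) (g k) (pos k)) m = c"
  using assms lc_gen_nonzero[OF assms(1)]
  by (simp add: pscale_apply lookup_single_times mon_diff_dvd mon_diff_diff lc_def)

text \<open>Both elements are homogeneous of the same degree, so subtracting equal coefficients at the
  position \<open>i\<close> clears that position completely.\<close>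

lemma cancel_lead:
  assumes "homogeneous target_deg m r" "homogeneous target_deg m w" "i < s"
    and "\<And>j. r j \<noteq> 0 \<Longrightarrow> j < s \<and> (j = i \<or> rk j < rk i)"
    and "\<And>j. w j \<noteq> 0 \<Longrightarrow> j < s \<and> (j = i \<or> rk j < rk i)"
    and "lookup (r i) m = lookup (w i) m"
  shows "homogeneous target_deg m (r - w)" "(r - w) j \<noteq> 0 \<Longrightarrow> j < s \<and> rk j < rk i"
proof -
  show hom: "homogeneous target_deg m (r - w)"
    using assms by (intro homogeneous_diff)
  have "(r - w) i = 0"
    unfolding homogeneous_eq_0_iff[OF hom] using assms(6) by (simp add: lookup_minus)
  moreover have "r j \<noteq> 0 \<or> w j \<noteq> 0" if "(r - w) j \<noteq> 0" using that by auto
  ultimately show "(r - w) j \<noteq> 0 \<Longrightarrow> j < s \<and> rk j < rk i"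
    using assms(4,5)[of j] by (cases "j = i") auto
qed

lemma scaled_gen_tail:
  "k \<in> index_set \<Longrightarrow> pscale p (g k) j \<noteq> 0 \<Longrightarrow> j < s \<and> (j = pos k \<or> rk j < rk (pos k))"
  using gen_tail[of k j] mult_zero_right[of p] unfolding pscale_apply by metis

lemma division_step:
  assumes r: "homogeneous target_deg m r" "r \<noteq> 0" "\<forall>i\<ge>s. r i = 0"
    and k: "k \<in> index_set" "lm_dvd ord (g k) r"
    and p: "p = single (snd (lm ord r) - mon k) (lc ord r / lc ord (g k))"
  defines "r' \<equiv> r - pscale p (g k)"
  shows "homogeneous target_deg m r'" and "r (pos k) \<noteq> 0"
    and "r' j \<noteq> 0 \<Longrightarrow> j < s \<and> rk j < rk (pos k)"
    and "keys p \<subseteq> {m - mon k}" and "mon_dvd (mon k) m"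
proof -
  obtain i where i: "i < s" "lm ord r = (i, m)" "r i \<noteq> 0"
      "\<forall>j. r j \<noteq> 0 \<longrightarrow> j < s \<and> (j = i \<or> rk j < rk i)"
    using lm_homogeneous[OF r(1,2)] r(3) by blast
  have ik: "i = pos k" and dvd: "mon_dvd (mon k) m"
    using k(2) i(2) by (auto simp: lm_dvd_def)
  have p': "p = single (m - mon k) (lookup (r i) m / lc ord (g k))"
    unfolding p i(2) by (simp add: lc_def i(2))
  show "r (pos k) \<noteq> 0" "keys p \<subseteq> {m - mon k}" "mon_dvd (mon k) m"
    using i(3) ik dvd p' by auto
  have w: "homogeneous target_deg m (pscale p (g k))"
    unfolding p' by (rule homogeneous_scale_single[OF homogeneous_gen[OF k(1)] dvd])
  have eq: "lookup (r i) m = lookup (pscale p (g k) i) m"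
    unfolding p' ik using lookup_pscale_gen_pos[OF k(1) dvd] by simp
  have tail: "j < s \<and> (j = i \<or> rk j < rk i)" if "pscale p (g k) j \<noteq> 0" for j
    using scaled_gen_tail[OF k(1) that] ik by simp
  show "homogeneous target_deg m r'" "r' j \<noteq> 0 \<Longrightarrow> j < s \<and> rk j < rk (pos k)"
    using cancel_lead[OF r(1) w i(1) _ tail eq] i(4) ik unfolding r'_def by auto
qed

lemma lead_monomial_reducible:
  assumes "(i, a) \<in> lead_monomials V"
  shows "(i, a) \<in> U_monomials s \<alpha> \<or> (\<exists>j\<in>J. pos (Inl j) = i \<and> mon_dvd (mon (Inl j)) a)"
proof -
  have "(i, a) \<in> multiples ((\<lambda>j. lm ord (h j)) ` J) \<union> U_monomials s \<alpha>"
    using assms groebner unfolding groebner_form_iff by blast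
  then show ?thesis
  proof
    assume "(i, a) \<in> multiples ((\<lambda>j. lm ord (h j)) ` J)"
    then obtain b j where "j \<in> J" "mon_dvd b a" "(i, b) = lm ord (h j)"
      unfolding multiples_def by blast
    then have "pos (Inl j) = i" "mon_dvd (mon (Inl j)) a"
      by (metis fst_conv gen_simps(1), metis snd_conv gen_simps(1))
    then show ?thesis using \<open>j \<in> J\<close> by blast
  qed blast
qed

lemma U_monomial_iff_gE_dvd:
  assumes "lm ord r = (i, a)" "i < s"
  shows "(i, a) \<in> U_monomials s \<alpha> \<longleftrightarrow> (\<exists>k. lm_dvd ord (g (Inr (i, k))) r)"
  using assms
  by (auto simp: U_monomials_def lm_dvd_def lm_gE single_dvd_iff deg_of_def le_fun_def)

text \<open>A division step lowers the leading position of \<open>r\<close>, because \<open>r\<close> has only one term in each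
  position. So the rank of the leading position serves as induction measure. Reducibility of
  the leading monomial at every step is the Groebner property.\<close>

lemma division_exists:
  assumes "homogeneous target_deg m r" "r \<in> V" "\<And>i. r i \<noteq> 0 \<Longrightarrow> rk i < N"
  shows "\<exists>a. division ord s J g r a"
  using assms
proof (induction N arbitrary: r)
  case 0
  then have "r = 0" by (auto simp: fun_eq_iff)
  then show ?case using division.zero by blast
next
  case (Suc N)
  show ?case
  proof (cases "r = 0")
    case True
    then show ?thesis using division.zero by blast
  next
    case False
    note bound = Vmod_bounded[OF Suc.prems(2)]
    obtain i where i: "i < s" "lm ord r = (i, m)" "r i \<noteq> 0"
      using lm_homogeneous[OF Suc.prems(1) False] bound by blast
    have "(i, m) \<in> lead_monomials V"
      unfolding lead_monomials_def using i(2) Suc.prems(2) False by (metis (mono_tags, lifting) mem_Collect_eq)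
    have "\<exists>k\<in>index_set. lm_dvd ord (g k) r \<and>
       (k \<in> range Inl \<longrightarrow> (\<forall>l\<in>Inr ` ({..<s} \<times> UNIV). \<not> lm_dvd ord (g l) r))"
    proof (cases "(i, m) \<in> U_monomials s \<alpha>")
      case True
      then obtain k where "lm_dvd ord (g (Inr (i, k))) r"
        using U_monomial_iff_gE_dvd[OF i(2,1)] by blast
      then show ?thesis using i(1) by (intro bexI[of _ "Inr (i, k)"]) auto
    next
      case no_U: False
      then obtain j where j: "j \<in> J" "pos (Inl j) = i" "mon_dvd (mon (Inl j)) m"
        using lead_monomial_reducible[OF \<open>(i, m) \<in> lead_monomials V\<close>] by blast
      have "\<not> lm_dvd ord (g (Inr (l, k))) r" if "l < s" for l k
        using no_U U_monomial_iff_gE_dvd[OF i(2,1)] that i(2)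
        by (cases "l = i") (auto simp: lm_dvd_def lm_gE)
      then show ?thesis
        using j i(2) by (intro bexI[of _ "Inl j"]) (auto simp: lm_dvd_def)
    qed
    then obtain k where k: "k \<in> index_set" "lm_dvd ord (g k) r"
      "k \<in> range Inl \<Longrightarrow> \<forall>l\<in>Inr ` ({..<s} \<times> UNIV). \<not> lm_dvd ord (g l) r" by blast
    define p where "p = single (snd (lm ord r) - mon k) (lc ord r / lc ord (g k))"
    note step = division_step[OF Suc.prems(1) False bound k(1,2) p_def]
    have "r - pscale p (g k) \<in> V"
      by (intro R.subspace_diff[OF subspace_Vmod] R.subspace_scale[OF subspace_Vmod] Suc.prems
          gen_in_V[OF k(1)])
    moreover have "rk j < N" if "(r - pscale p (g k)) j \<noteq> 0" for j
      using step(3)[OF that] Suc.prems(3)[OF step(2)] by simp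
    ultimately obtain a where "division ord s J g (r - pscale p (g k)) a"
      using Suc.IH[OF step(1)] by blast
    then show ?thesis using division.step[OF False k p_def] by blast
  qed
qed

abbreviation "column_quotients a \<equiv> (\<lambda>j. if j \<in> J then a (Inl j) else 0)"

text \<open>The quotients express \<open>r\<close> by the columns up to an element of \<open>U\<close>, which is contributed by the
  steps with divisors in \<open>G\<^sub>E\<close>. Leading positions only decrease during the division, hence
  every column that is used has its leading position below \<open>N\<close>, if \<open>r\<close> lives below \<open>N\<close>.\<close>

lemma division_quotients:
  assumes "division ord s J g r a"
    and "homogeneous target_deg m r" "\<And>i. r i \<noteq> 0 \<Longrightarrow> i < s \<and> rk i < N"
  shows "homogeneous source_deg m (column_quotients a) \<and>
    r - column_sum s \<beta> A J (column_quotients a) \<in> U \<and>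
    (\<forall>j\<in>J. a (Inl j) \<noteq> 0 \<longrightarrow> rk (pos (Inl j)) < N)"
  using assms
proof (induction rule: division.induct)
  case zero
  have "column_quotients (\<lambda>_ :: 'v gidx. 0 :: ('v, 'k) mpoly) = 0" by auto
  then show ?case using R.subspace_0[OF subspace_Umod]
    by (simp only: column_sum_zero homogeneous_zero diff_zero) simp
next
  case (step r k p a)
  let ?r = "r - pscale p (g k)"
  have bound: "\<forall>i\<ge>s. r i = 0" using step.prems(2) not_less by blast
  note div = division_step[OF step.prems(1) step.hyps(1) bound step.hyps(2,3,5)]
  have posN: "rk (pos k) < N" using step.prems(2)[OF div(2)] by blast
  have "i < s \<and> rk i < N" if "?r i \<noteq> 0" for i
    using div(3)[OF that] posN less_trans by blast
  then have IH: "homogeneous source_deg m (column_quotients a) \<and>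
      ?r - column_sum s \<beta> A J (column_quotients a) \<in> U \<and>
      (\<forall>j\<in>J. a (Inl j) \<noteq> 0 \<longrightarrow> rk (pos (Inl j)) < N)"
    by (rule step.IH[OF div(1)])
  show ?case
  proof (cases k)
    case (Inl j)
    then have j: "j \<in> J" using step.hyps(2) by auto
    let ?e = "\<lambda>l. if l = j then p else 0"
    have eq: "column_quotients (a(k := a k + p)) = column_quotients a + ?e"
      using j by (auto simp: Inl fun_eq_iff)
    have "homogeneous source_deg m ?e"
      unfolding homogeneous_def
    proof (intro allI ballI)
      fix l b assume "b \<in> keys (?e l)"
      then have "l = j" "b = m - source_deg j"
        using div(4) mon_Inl[OF j] by (auto simp: Inl split: if_splits)
      then show "source_deg l + b = m"
        using div(5) mon_Inl[OF j] mon_add_diff by (simp add: Inl)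
    qed
    moreover have "r - column_sum s \<beta> A J (column_quotients a + ?e)
        = ?r - column_sum s \<beta> A J (column_quotients a)"
      unfolding column_sum_add column_sum_unit[OF finite_J j] Inl gen_simps by (simp only: diff_diff_eq add.commute)
    ultimately have "homogeneous source_deg m (column_quotients a + ?e)"
      and "r - column_sum s \<beta> A J (column_quotients a + ?e) \<in> U"
      using IH by (simp_all only: homogeneous_add)
    moreover have "\<forall>l\<in>J. (a(k := a k + p)) (Inl l) \<noteq> 0 \<longrightarrow> rk (pos (Inl l)) < N"
      using IH[THEN conjunct2, THEN conjunct2] posN unfolding Inl by simp
    ultimately show ?thesis unfolding eq by blast
  next
    case (Inr x)
    then obtain i l where x: "x = (i, l)" "i < s" using step.hyps(2) by auto
    have eq: "column_quotients (a(k := a k + p)) = column_quotients a"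
      by (auto simp: Inr fun_eq_iff)
    have "r - column_sum s \<beta> A J (column_quotients a)
        = (?r - column_sum s \<beta> A J (column_quotients a)) + pscale p (g k)"
      by (simp only: diff_diff_eq add.commute diff_add_eq diff_add_cancel) simp
    also have "\<dots> \<in> U"
      using IH gE_in_U[OF x(2), of l] unfolding Inr x(1) gen_simps
      by (intro R.subspace_add[OF subspace_Umod] R.subspace_scale[OF subspace_Umod]) auto
    finally have "r - column_sum s \<beta> A J (column_quotients a) \<in> U" .
    moreover have "\<forall>l\<in>J. (a(k := a k + p)) (Inl l) \<noteq> 0 \<longrightarrow> rk (pos (Inl l)) < N"
      using IH[THEN conjunct2, THEN conjunct2] unfolding Inr by simp
    ultimately show ?thesis unfolding eq using IH by blast
  qed
qed

end


section \<open>Schreyer's theorem\<close>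

context groebner_columns
begin

lemma spairs_index:
  assumes "(i, l) \<in> spairs ord s J g"
  shows "i \<in> J" "Inl i \<in> index_set" "l \<in> index_set" "pos (Inl i) = pos l"
  using assms unfolding spairs_def by auto

text \<open>Both summands have coefficient \<open>1\<close> at their common leading monomial, so the top position
  cancels.\<close>

lemma s_vector:
  assumes k: "k \<in> index_set" and l: "l \<in> index_set" and pos: "pos k = pos l"
  defines "r \<equiv> pscale (cofactor ord (g k) (g l)) (g k) - pscale (cofactor ord (g l) (g k)) (g l)"
    and "m \<equiv> lcm_mon (mon k) (mon l)"
  shows "homogeneous target_deg m r" and "r j \<noteq> 0 \<Longrightarrow> j < s \<and> rk j < rk (pos k)" and "r \<in> V"
proof -
  have dvd: "mon_dvd (mon k) m" "mon_dvd (mon l) m"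
    unfolding m_def by (rule mon_dvd_lcm)+
  have c: "cofactor ord (g k) (g l) = single (m - mon k) (1 / lc ord (g k))"
    "cofactor ord (g l) (g k) = single (m - mon l) (1 / lc ord (g l))"
    unfolding cofactor_def m_def lcm_mon_commute[of "mon l"] by simp_all
  have hom: "homogeneous target_deg m (pscale (single (m - mon k) (1 / lc ord (g k))) (g k))"
    "homogeneous target_deg m (pscale (single (m - mon l) (1 / lc ord (g l))) (g l))"
    by (rule homogeneous_scale_single[OF homogeneous_gen[OF k] dvd(1)],
        rule homogeneous_scale_single[OF homogeneous_gen[OF l] dvd(2)])
  note lead = lookup_pscale_gen_pos[OF k dvd(1), of 1] lookup_pscale_gen_pos[OF l dvd(2), of 1]
  have tail: "i < s \<and> (i = pos k \<or> rk i < rk (pos k))" if "pscale p (g l) i \<noteq> 0" for p i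
    using scaled_gen_tail[OF l that] pos by simp
  show "homogeneous target_deg m r" "r j \<noteq> 0 \<Longrightarrow> j < s \<and> rk j < rk (pos k)"
    unfolding r_def c
    using cancel_lead[OF hom pos_less[OF k] scaled_gen_tail[OF k] tail] lead pos by simp_all
  show "r \<in> V"
    unfolding r_def
    by (intro R.subspace_diff[OF subspace_Vmod] R.subspace_scale[OF subspace_Vmod] gen_in_V k l)
qed

lemma schreyer_matrix_exists: "\<exists>D. schreyer_matrix ord s J g D"
proof -
  have "\<forall>q. \<exists>a. q \<in> spairs ord s J g \<longrightarrow> division ord s J g
      (pscale (cofactor ord (g (Inl (fst q))) (g (snd q))) (g (Inl (fst q)))
       - pscale (cofactor ord (g (snd q)) (g (Inl (fst q)))) (g (snd q))) a"
  proof
    fix q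
    show "\<exists>a. q \<in> spairs ord s J g \<longrightarrow> division ord s J g
      (pscale (cofactor ord (g (Inl (fst q))) (g (snd q))) (g (Inl (fst q)))
       - pscale (cofactor ord (g (snd q)) (g (Inl (fst q)))) (g (snd q))) a"
    proof (cases "q \<in> spairs ord s J g")
      case True
      then have "(fst q, snd q) \<in> spairs ord s J g" by simp
      note q = spairs_index[OF this]
      note r = s_vector[OF q(2,3,4)]
      show ?thesis
        using division_exists[OF r(1,3), of "rk (pos (Inl (fst q)))"] r(2) by blast
    qed blast
  qed
  from choice[OF this] obtain a where a: "\<And>q. q \<in> spairs ord s J g \<Longrightarrow> division ord s J g
      (pscale (cofactor ord (g (Inl (fst q))) (g (snd q))) (g (Inl (fst q)))
       - pscale (cofactor ord (g (snd q)) (g (Inl (fst q)))) (g (snd q))) (a q)"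
    by (elim exE) blast
  show ?thesis
    unfolding schreyer_matrix_def
    by (rule exI[of _ "\<lambda>(i, l) j. if j \<in> J then
            (if j = i then cofactor ord (g (Inl i)) (g l) else 0)
            - (if Inl j = l then cofactor ord (g l) (g (Inl i)) else 0)
            - a (i, l) (Inl j) else 0"]) (use a in fastforce)
qed

definition syzygies :: "('v, 'k) vec set" where
  "syzygies = {f. column_sum s \<beta> A J f \<in> U}"

lemma subspace_syzygies: "R.subspace syzygies"
  unfolding R.subspace_def syzygies_def mem_Collect_eq
  by (simp only: column_sum_zero column_sum_add column_sum_scale)
     (intro conjI ballI allI impI R.subspace_0 R.subspace_add R.subspace_scale subspace_Umod, simp_all)

text \<open>A column of \<open>\<partial>\<^sub>1\<close> is a syzygy, as it records a division of an S-vector with remainder zero. By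
  the rank bound of the S-vector, the quotients involve lower leading positions only. So the
  entry in row \<open>i\<close> is the cofactor itself, and any other entry at the same or a higher
  leading position belongs to the second member of the pair.\<close>

lemma schreyer_column:
  assumes D: "schreyer_matrix ord s J g D" and il: "(i, l) \<in> spairs ord s J g"
  defines "m \<equiv> lcm_mon (mon (Inl i)) (mon l)"
  shows "D (i, l) \<in> free_mod J" and "homogeneous source_deg m (D (i, l))"
    and "D (i, l) \<in> syzygies"
    and "lookup (D (i, l) i) (m - source_deg i) \<noteq> 0"
    and "D (i, l) j \<noteq> 0 \<Longrightarrow> j = i \<or> l = Inl j \<or> rk (pos (Inl j)) < rk (pos (Inl i))"
proof -
  note idx = spairs_index[OF il]
  let ?c = "cofactor ord (g (Inl i)) (g l)" and ?d = "cofactor ord (g l) (g (Inl i))"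
  let ?r = "pscale ?c (g (Inl i)) - pscale ?d (g l)"
  obtain a where a: "division ord s J g ?r a"
    and Dil: "D (i, l) = (\<lambda>j. if j \<in> J then (if j = i then ?c else 0)
       - (if Inl j = l then ?d else 0) - a (Inl j) else 0)"
    using D il unfolding schreyer_matrix_def by blast
  have lc: "lc ord (g (Inl i)) \<noteq> 0" by (rule lc_gen_nonzero[OF idx(2)])
  have c: "?c = single (m - source_deg i) (1 / lc ord (g (Inl i)))"
    "?d = single (m - mon l) (1 / lc ord (g l))"
    unfolding cofactor_def m_def lcm_mon_commute[of "mon l"] by (simp_all add: mon_Inl[OF idx(1), simplified])
  have dvd: "mon_dvd (source_deg i) m" "mon_dvd (mon l) m"
    using mon_dvd_lcm mon_Inl[OF idx(1)] unfolding m_def by metis+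
  note s_vec = s_vector[OF idx(2,3,4), folded m_def]
  have q: "homogeneous source_deg m (column_quotients a)"
      "?r - column_sum s \<beta> A J (column_quotients a) \<in> U"
      "\<forall>j\<in>J. a (Inl j) \<noteq> 0 \<longrightarrow> rk (pos (Inl j)) < rk (pos (Inl i))"
    using division_quotients[OF a s_vec(1), of "rk (pos (Inl i))"] s_vec(2) by blast+
  have aii: "a (Inl i) = 0" using q(3) idx(1) by blast
  have not_il: "l \<noteq> Inl i" using il unfolding spairs_def by auto
  show "D (i, l) \<in> free_mod J" by (simp add: Dil free_mod_def)
  show "lookup (D (i, l) i) (m - source_deg i) \<noteq> 0"
    using aii idx(1) not_il lc unfolding Dil c by (auto simp: not_il[symmetric])
  show "D (i, l) j \<noteq> 0 \<Longrightarrow> j = i \<or> l = Inl j \<or> rk (pos (Inl j)) < rk (pos (Inl i))"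
    using q(3) unfolding Dil by (auto split: if_splits)
  show "homogeneous source_deg m (D (i, l))"
    unfolding homogeneous_def
  proof (intro allI ballI)
    fix j b assume b: "b \<in> keys (D (i, l) j)"
    then have j: "j \<in> J" by (auto simp: Dil split: if_splits)
    have "b \<in> keys (if j = i then ?c else 0) \<union> keys (if Inl j = l then ?d else 0)
        \<union> keys (column_quotients a j)"
      using b j unfolding Dil by (auto dest!: Poly_Mapping.keys_diff[THEN subsetD])
    then consider "j = i" "b = m - source_deg i" | "l = Inl j" "b = m - source_deg j"
      | "b \<in> keys (column_quotients a j)"
      using mon_Inl[OF j] unfolding c by (auto split: if_splits)
    then show "source_deg j + b = m"
    proof cases
      case 2
      then show ?thesis using dvd(2) mon_Inl[OF j] by (simp add: mon_add_diff)
    next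
      case 3
      then show ?thesis using q(1) unfolding homogeneous_def by blast
    qed (use dvd(1) in \<open>simp add: mon_add_diff\<close>)
  qed
  let ?e = "\<lambda>i p j. if j = i then p else 0"
  show "D (i, l) \<in> syzygies"
  proof (cases l)
    case (Inl j)
    then have j: "j \<in> J" using idx(3) by auto
    have "D (i, l) = ?e i ?c - ?e j ?d - column_quotients a"
      unfolding Dil using idx(1) j by (auto simp: Inl fun_eq_iff)
    then have "column_sum s \<beta> A J (D (i, l)) = ?r - column_sum s \<beta> A J (column_quotients a)"
      by (simp only: column_sum_diff column_sum_unit[OF finite_J idx(1)] column_sum_unit[OF finite_J j]
          gen_simps Inl)
    then show ?thesis unfolding syzygies_def using q(2) by (simp only: mem_Collect_eq)
  next
    case (Inr x)
    obtain i' k where x: "x = (i', k)" "i' < s" using idx(3) Inr by auto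
    have "D (i, l) = ?e i ?c - column_quotients a"
      unfolding Dil using idx(1) by (auto simp: Inr fun_eq_iff)
    then have "column_sum s \<beta> A J (D (i, l)) =
        (?r - column_sum s \<beta> A J (column_quotients a)) + pscale ?d (g l)"
      by (simp only: column_sum_diff column_sum_unit[OF finite_J idx(1)] gen_simps) (simp add: algebra_simps)
    also have "\<dots> \<in> U"
      using gE_in_U[OF x(2), of k] q(2) unfolding Inr x(1) gen_simps
      by (intro R.subspace_add[OF subspace_Umod] R.subspace_scale[OF subspace_Umod])
    finally show ?thesis unfolding syzygies_def by blast
  qed
qed

lemma lookup_column_sum:
  assumes "homogeneous source_deg m f" and "i < s"
  shows "lookup (column_sum s \<beta> A J f i) m = (\<Sum>j\<in>J. lookup (f j) (m - source_deg j) * A i j)"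
proof -
  have "lookup (f j * single (source_deg j) (A i j)) m = lookup (f j) (m - source_deg j) * A i j" for j
    using homogeneous_entry[OF assms(1), of j] by (auto simp: lookup_times_single)
  then show ?thesis
    using assms(2) by (simp add: column_sum_def sum_fun_apply lookup_sum pscale_apply hcol_def)
qed

text \<open>A homogeneous syzygy \<open>f\<close> of degree \<open>m\<close> involves, at its top position \<open>i\<close>, a column \<open>j\<^sub>1\<close>.
  If \<open>X\<^sup>m e\<^sub>i\<close> lies in \<open>U\<close>, it is a multiple of an element of \<open>G\<^sub>E\<close>, which forms a pair with
  \<open>j\<^sub>1\<close>. Otherwise the coefficient of \<open>X\<^sup>m e\<^sub>i\<close> in the sum of the \<open>f\<^sub>j h\<^sub>j\<close> is zero; columns with
  a lower leading position do not contribute to it, so the contribution of \<open>j\<^sub>1\<close> is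
  cancelled by a second column with leading position \<open>i\<close>.\<close>

lemma reducing_pair:
  assumes f: "f \<in> free_mod J" "homogeneous source_deg m f" "f \<in> syzygies"
    and max: "\<And>j. j \<in> J \<Longrightarrow> f j \<noteq> 0 \<Longrightarrow> rk (pos (Inl j)) \<le> rk (pos (Inl j\<^sub>1))"
    and j\<^sub>1: "j\<^sub>1 \<in> J" "f j\<^sub>1 \<noteq> 0"
  shows "\<exists>j l. (j, l) \<in> spairs ord s J g \<and> f j \<noteq> 0 \<and> pos (Inl j) = pos (Inl j\<^sub>1) \<and>
    mon_dvd (lcm_mon (mon (Inl j)) (mon l)) m \<and> (\<forall>j'. l = Inl j' \<longrightarrow> f j' \<noteq> 0)"
proof -
  let ?i = "pos (Inl j\<^sub>1)"
  have i: "?i < s" using pos_less[of "Inl j\<^sub>1"] j\<^sub>1(1) by auto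
  have dvd: "mon_dvd (mon (Inl j)) m" if "j \<in> J" "f j \<noteq> 0" for j
    using homogeneous_mon_dvd[OF f(2) that(2)] mon_Inl[OF that(1)] by simp
  show ?thesis
  proof (cases "deg_of m \<le> \<alpha> ?i")
    case False
    then obtain k where k: "mon_dvd (single k (nat (\<alpha> ?i k + 1))) m"
      by (auto simp: single_dvd_iff deg_of_def le_fun_def)
    have lm: "lm ord (g (Inr (?i, k))) = (?i, single k (nat (\<alpha> ?i k + 1)))"
      using lm_gE[OF i] by simp
    have "(j\<^sub>1, Inr (?i, k)) \<in> spairs ord s J g"
      using j\<^sub>1(1) i lm unfolding spairs_def by auto
    moreover have "mon_dvd (lcm_mon (mon (Inl j\<^sub>1)) (mon (Inr (?i, k)))) m"
      using dvd[OF j\<^sub>1] k unfolding lm snd_conv by (rule lcm_mon_dvd)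
    ultimately show ?thesis using j\<^sub>1(2) by blast
  next
    case True
    have hom: "homogeneous target_deg m (column_sum s \<beta> A J f)"
      by (rule homogeneous_column_sum[OF f(2)])
    have "column_sum s \<beta> A J f ?i = 0"
      using f(3) True i homogeneous_in_Umod_iff[where \<alpha> = \<alpha>, OF hom column_sum_bounded]
      unfolding syzygies_def by blast
    then have sum0: "(\<Sum>j\<in>J. lookup (f j) (m - source_deg j) * A ?i j) = 0"
      using lookup_column_sum[OF f(2) i] by simp
    have "lookup (f j\<^sub>1) (m - source_deg j\<^sub>1) * A ?i j\<^sub>1 \<noteq> 0"
      using homogeneous_eq_0_iff[OF f(2), of j\<^sub>1] j\<^sub>1 gen_pos_nonzero[of "Inl j\<^sub>1"]
      by (simp add: hcol_eq_0_iff)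
    then have "\<exists>j\<^sub>2\<in>J - {j\<^sub>1}. lookup (f j\<^sub>2) (m - source_deg j\<^sub>2) * A ?i j\<^sub>2 \<noteq> 0"
      using sum0 sum.remove[OF finite_J j\<^sub>1(1), of "\<lambda>j. lookup (f j) (m - source_deg j) * A ?i j"]
      by (metis (no_types, lifting) add_0_right sum.neutral)
    then obtain j\<^sub>2 where "j\<^sub>2 \<in> J - {j\<^sub>1}" "lookup (f j\<^sub>2) (m - source_deg j\<^sub>2) * A ?i j\<^sub>2 \<noteq> 0"
      by blast
    then have j\<^sub>2: "j\<^sub>2 \<in> J" "j\<^sub>2 \<noteq> j\<^sub>1" "f j\<^sub>2 \<noteq> 0" "A ?i j\<^sub>2 \<noteq> 0" by auto
    have "?i = pos (Inl j\<^sub>2) \<or> rk ?i < rk (pos (Inl j\<^sub>2))"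
      using gen_tail[of "Inl j\<^sub>2" ?i] j\<^sub>2 i by (simp add: hcol_eq_0_iff)
    then have pos2: "pos (Inl j\<^sub>2) = ?i" using max[OF j\<^sub>2(1,3)] by auto
    \<comment> \<open>a pair of two columns lists the smaller index first\<close>
    define j j' where "j = min j\<^sub>1 j\<^sub>2" and "j' = max j\<^sub>1 j\<^sub>2"
    have jj': "j \<in> J" "j' \<in> J" "j < j'" "f j \<noteq> 0" "f j' \<noteq> 0" "pos (Inl j) = ?i" "pos (Inl j') = ?i"
      using j\<^sub>1 j\<^sub>2 pos2 unfolding j_def j'_def by (auto simp: min_def max_def)
    then have "(j, Inl j') \<in> spairs ord s J g" unfolding spairs_def by simp
    moreover have "mon_dvd (lcm_mon (mon (Inl j)) (mon (Inl j'))) m"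
      using dvd jj' by (intro lcm_mon_dvd)
    ultimately show ?thesis using jj' by blast
  qed
qed

text \<open>Induction on a bound for the leading positions of the columns in use and, for a given bound,
  on the number of columns that attain it. The reducing pair \<open>(j, l)\<close> removes \<open>j\<close>. If \<open>l\<close> is a
  column, it occurs in \<open>f\<close> already, so no column attaining the bound is added.\<close>

lemma homogeneous_syzygy_in_span:
  assumes D: "schreyer_matrix ord s J g D"
    and "f \<in> free_mod J" "homogeneous source_deg m f" "f \<in> syzygies"
    and "\<And>j. j \<in> J \<Longrightarrow> f j \<noteq> 0 \<Longrightarrow> rk (pos (Inl j)) < N"
  shows "f \<in> R.span (D ` spairs ord s J g)"
  using assms(2-)
proof (induction N arbitrary: f)
  case 0
  then have "f = 0" unfolding free_mod_def by (auto simp: fun_eq_iff)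
  then show ?case using R.span_zero by metis
next
  case (Suc N)
  from Suc.prems show ?case
  proof (induction "card {j \<in> J. f j \<noteq> 0 \<and> rk (pos (Inl j)) = N}" arbitrary: f rule: less_induct)
    case less
    let ?T = "\<lambda>f. {j \<in> J. f j \<noteq> 0 \<and> rk (pos (Inl j)) = N}"
    show ?case
    proof (cases "?T f = {}")
      case True
      then have "rk (pos (Inl j)) < N" if "j \<in> J" "f j \<noteq> 0" for j
        using less.prems(4)[OF that] that by (auto simp: less_Suc_eq)
      then show ?thesis by (rule Suc.IH[OF less.prems(1,2,3)])
    next
      case False
      then obtain j\<^sub>1 where j\<^sub>1: "j\<^sub>1 \<in> J" "f j\<^sub>1 \<noteq> 0" "rk (pos (Inl j\<^sub>1)) = N" by blast
      have max: "rk (pos (Inl j)) \<le> rk (pos (Inl j\<^sub>1))" if "j \<in> J" "f j \<noteq> 0" for j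
        using less.prems(4)[OF that] j\<^sub>1(3) by simp
      obtain j l where jl: "(j, l) \<in> spairs ord s J g" "f j \<noteq> 0" "pos (Inl j) = pos (Inl j\<^sub>1)"
        and dvd: "mon_dvd (lcm_mon (mon (Inl j)) (mon l)) m"
        and l: "\<And>j'. l = Inl j' \<Longrightarrow> f j' \<noteq> 0"
        using reducing_pair[OF less.prems(1,2,3) max j\<^sub>1(1,2)] by blast
      let ?n = "lcm_mon (mon (Inl j)) (mon l)"
      note col = schreyer_column[OF D jl(1)]
      have j: "j \<in> J" by (rule spairs_index[OF jl(1)])
      define e where "e = lookup (D (j, l) j) (?n - source_deg j)"
      have e: "e \<noteq> 0" using col(4) unfolding e_def .
      \<comment> \<open>the multiple of the column \<open>(j, l)\<close> is chosen to agree with \<open>f\<close> in the entry \<open>j\<close>\<close>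
      define p where "p = single (m - ?n) (lookup (f j) (m - source_deg j) / e)"
      define f' where "f' = f - pscale p (D (j, l))"
      have Dj: "D (j, l) j = single (?n - source_deg j) e" "mon_dvd (source_deg j) ?n"
        using homogeneous_entry[OF col(2), of j] e unfolding e_def by (auto split: if_splits)
      have deg: "m - ?n + (?n - source_deg j) = m - source_deg j"
        using dvd Dj(2) mon_dvd_trans[OF Dj(2) dvd] unfolding mon_dvd_iff
        by (intro poly_mapping_eqI) (auto simp: lookup_add lookup_minus simp del: lookup_lcm_mon lookup_mon_of)
      have "f j = single (m - source_deg j) (lookup (f j) (m - source_deg j))"
        using homogeneous_entry[OF less.prems(2), of j] jl(2) by (auto split: if_splits)
      then have f'j: "f' j = 0"
        using e deg unfolding f'_def p_def by (simp add: pscale_apply Dj(1) mult_single)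
      have f'_supp: "f j' \<noteq> 0 \<or> rk (pos (Inl j')) < N" if "f' j' \<noteq> 0" for j'
      proof (rule ccontr)
        assume *: "\<not> (f j' \<noteq> 0 \<or> rk (pos (Inl j')) < N)"
        then have "D (j, l) j' \<noteq> 0" using that unfolding f'_def by (auto simp: pscale_apply)
        from col(5)[OF this] have "j' = j \<or> l = Inl j' \<or> rk (pos (Inl j')) < N"
          using jl(3) j\<^sub>1(3) by simp
        then show False using * jl(2) l by (elim disjE) simp_all
      qed
      have "?T f' \<subseteq> ?T f - {j}" using f'_supp f'j by auto
      moreover have "j \<in> ?T f" using j jl(2,3) j\<^sub>1(3) by simp
      ultimately have "?T f' \<subset> ?T f" by blast
      then have "card (?T f') < card (?T f)"
        using finite_J by (intro psubset_card_mono) auto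
      moreover have "f' \<in> free_mod J"
        using less.prems(1) col(1) unfolding f'_def by (simp add: free_mod_def pscale_apply)
      moreover have "homogeneous source_deg m f'"
        unfolding f'_def p_def
        by (rule homogeneous_diff[OF less.prems(2) homogeneous_scale_single[OF col(2) dvd]])
      moreover have "f' \<in> syzygies"
        unfolding f'_def by (intro R.subspace_diff[OF subspace_syzygies] R.subspace_scale[OF subspace_syzygies]
          less.prems(3) col(3))
      moreover have "rk (pos (Inl j')) < Suc N" if "j' \<in> J" "f' j' \<noteq> 0" for j'
        using f'_supp[OF that(2)] less.prems(4)[OF that(1)] by auto
      ultimately have "f' \<in> R.span (D ` spairs ord s J g)" by (rule less.hyps)
      moreover have "f = f' + pscale p (D (j, l))" unfolding f'_def by simp
      moreover have "pscale p (D (j, l)) \<in> R.span (D ` spairs ord s J g)"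
        by (intro R.span_scale R.span_base imageI jl(1))
      ultimately show ?thesis using R.span_add by metis
    qed
  qed
qed

text \<open>The syzygies form a graded submodule, so the homogeneous case suffices.\<close>

lemma schreyer:
  assumes D: "schreyer_matrix ord s J g D" and f: "f \<in> free_mod J" "f \<in> syzygies"
  shows "f \<in> R.span (D ` spairs ord s J g)"
proof -
  obtain T where T: "f = (\<Sum>m\<in>T. component source_deg m f)"
    using sum_components[OF finite_J, of f source_deg] f(1) unfolding free_mod_def by blast
  have "component source_deg m f \<in> R.span (D ` spairs ord s J g)" for m
  proof (rule homogeneous_syzygy_in_span[OF D])
    show "component source_deg m f \<in> free_mod J"
      using f(1) by (auto simp: free_mod_def component_def)
    show "homogeneous source_deg m (component source_deg m f)"
      by (rule homogeneous_component)
    show "component source_deg m f \<in> syzygies"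
    proof -
      have "component target_deg m (column_sum s \<beta> A J f) \<in> U"
        using f(2) homogeneous_mvec unfolding syzygies_def Umod_def
        by (intro component_in_span) (auto simp: gE_def)
      then show ?thesis
        unfolding syzygies_def by (simp only: component_column_sum mem_Collect_eq)
    qed
    show "rk (pos (Inl j)) < Suc (Max ((\<lambda>j. rk (pos (Inl j))) ` J))" if "j \<in> J" for j
      using that finite_J by (auto simp: less_Suc_eq_le)
  qed
  then have "(\<Sum>m\<in>T. component source_deg m f) \<in> R.span (D ` spairs ord s J g)"
    by (intro R.span_sum)
  then show ?thesis using T by metis
qed

end

section \<open>Pruning\<close>

lemma prune_terminates:
  assumes "finite (fst (S 0))"
  shows "\<not> (\<forall>i. prune_step (S i) (S (Suc i)))"
proof
  assume steps: "\<forall>i. prune_step (S i) (S (Suc i))"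
  have step: "finite (fst T) \<Longrightarrow> finite (fst T') \<and> card (fst T') < card (fst T)" if "prune_step T T'" for T T'
    using that by cases (auto simp: card_gt_0_iff intro!: diff_less)
  have fin: "finite (fst (S i))" for i
    by (induction i) (use assms step steps in blast)+
  have "card (fst (S i)) + i \<le> card (fst (S 0))" for i
  proof (induction i)
    case (Suc i)
    then show ?case using step[OF steps[rule_format, of i] fin[of i]] by simp
  qed simp
  from this[of "Suc (card (fst (S 0)))"] show False by simp
qed

text \<open>The invariant of pruning, for the submodule \<open>K\<close> of relations between the generators
  \<open>J\<^sub>0\<close>: the columns are homogeneous and generate the relations between the remaining
  generators, and the remaining generators still generate everything modulo \<open>K\<close>.
  A homogeneous entry that is not a non-zero constant lies in the maximal ideal, while
  \<open>1 + X\<^sub>1\<close> shows that homogeneity has to be kept track of.\<close>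

definition presents ::
  "(nat \<Rightarrow> 'v mon) \<Rightarrow> nat set \<Rightarrow> ('v, 'k::field) vec set \<Rightarrow> ('v, 'k, 'p) prune_state \<Rightarrow> bool" where
  "presents B J\<^sub>0 K S \<longleftrightarrow> (case S of (J, P, D) \<Rightarrow> J \<subseteq> J\<^sub>0 \<and>
     (\<forall>q\<in>P. D q \<in> free_mod J \<inter> K \<and> (\<exists>m. homogeneous B m (D q))) \<and>
     free_mod J \<inter> K \<subseteq> R.span (D ` P) \<and>
     (\<forall>f\<in>free_mod J\<^sub>0. \<exists>f'\<in>free_mod J. f - f' \<in> K))"

lemma subspace_free_mod: "R.subspace (free_mod J)"
  by (auto simp: R.subspace_def free_mod_def pscale_apply)

text \<open>Column operations with the pivot column \<open>D p\<close> make the row \<open>j\<close> zero in all other columns. In a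
  relation that does not involve the generator \<open>j\<close>, the pivot column then has
  coefficient \<open>0\<close>, since it is the only one with a non-zero entry in row \<open>j\<close>. The same
  operation applied to an arbitrary element rewrites it without the generator \<open>j\<close>.\<close>

lemma prune_step_presents:
  assumes "prune_step S S'" and "presents B J\<^sub>0 K S" and K: "R.subspace K"
  shows "presents B J\<^sub>0 K S'"
  using assms(1)
proof cases
  case (1 j J p P c D)
  note S = 1(1) and S' = 1(2) and j = 1(3) and p = 1(4) and c = 1(5) and Dpj = 1(6)
  have JJ\<^sub>0: "J \<subseteq> J\<^sub>0"
    and D_free: "\<And>q. q \<in> P \<Longrightarrow> D q \<in> free_mod J" and D_K: "\<And>q. q \<in> P \<Longrightarrow> D q \<in> K"
    and D_hom: "\<And>q. q \<in> P \<Longrightarrow> \<exists>m. homogeneous B m (D q)"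
    and gen: "free_mod J \<inter> K \<subseteq> R.span (D ` P)"
    and surj: "\<And>f. f \<in> free_mod J\<^sub>0 \<Longrightarrow> \<exists>f'\<in>free_mod J. f - f' \<in> K"
    using assms(2) unfolding S presents_def by auto
  let ?D = "\<lambda>q. D q - pscale (cst (1 / c) * D q j) (D p)"
  have clear: "(f - pscale (cst (1 / c) * f j) (D p)) j = 0" for f
  proof -
    have "cst (1 / c) * f j * cst c = (cst (1 / c) * cst c) * f j" by (simp only: mult_ac)
    also have "\<dots> = f j" using c by (simp add: cst_def mult_single)
    finally show ?thesis by (simp add: pscale_apply Dpj)
  qed
  have clear_free: "f - pscale (cst (1 / c) * f j) (D p) \<in> free_mod (J - {j})" if "f \<in> free_mod J" for f
  proof -
    have "f - pscale (cst (1 / c) * f j) (D p) \<in> free_mod J"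
      by (intro R.subspace_diff[OF subspace_free_mod] R.subspace_scale[OF subspace_free_mod] that D_free p)
    then show ?thesis using clear[of f] unfolding free_mod_def by auto
  qed
  have clear_K: "pscale r (D p) \<in> K" for r
    by (intro R.subspace_scale[OF K] D_K p)
  have "\<exists>m. homogeneous B m (?D q)" if q: "q \<in> P" for q
  proof (cases "D q j = 0")
    case True
    then show ?thesis using D_hom[OF q] by simp
  next
    case False
    obtain m where m: "homogeneous B m (D q)" using D_hom[OF q] by blast
    obtain n where n: "homogeneous B n (D p)" using D_hom[OF p] by blast
    have "n = B j" using n c unfolding homogeneous_def by (metis Dpj cst_def Poly_Mapping.keys_single add_0_right singletonI)
    have Dqj: "D q j = single (m - B j) (lookup (D q j) (m - B j))" "mon_dvd (B j) m"
      using homogeneous_entry[OF m, of j] False by (auto split: if_splits)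
    have "homogeneous B m (pscale (cst (1 / c) * D q j) (D p))"
      unfolding cst_def by (subst Dqj(1), subst mult_single, unfold add_0_left \<open>n = B j\<close>[symmetric])
        (rule homogeneous_scale_single[OF n], simp add: \<open>n = B j\<close> Dqj(2))
    then show ?thesis using homogeneous_diff[OF m] by blast
  qed
  moreover have "?D q \<in> free_mod (J - {j}) \<inter> K" if "q \<in> P" for q
    using clear_free[OF D_free[OF that]] R.subspace_diff[OF K D_K[OF that] clear_K] by blast
  moreover have "free_mod (J - {j}) \<inter> K \<subseteq> R.span (?D ` (P - {p}))"
  proof
    fix f assume f: "f \<in> free_mod (J - {j}) \<inter> K"
    then have "f \<in> R.span (D ` P)" using gen unfolding free_mod_def by auto
    then have "\<exists>x\<in>R.span (?D ` (P - {p})). \<exists>r. f = x + pscale r (D p)"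
    proof (induction rule: R.span_induct_alt)
      case base
      show ?case
        by (rule bexI[OF exI[of _ 0] R.span_zero]) (simp only: R.scale_zero_left add_0_left)
    next
      case (step r y z)
      then obtain q x r' where q: "q \<in> P" "y = D q"
        and x: "x \<in> R.span (?D ` (P - {p}))" "z = x + pscale r' (D p)" by blast
      show ?case
      proof (cases "q = p")
        case True
        then have "pscale r y + z = x + pscale (r + r') (D p)"
          unfolding x q by (simp only: R.scale_left_distrib add_ac)
        then show ?thesis using x(1) by blast
      next
        case False
        have "pscale r y + z = (pscale r (?D q) + x) + pscale (r * (cst (1 / c) * D q j) + r') (D p)"
          unfolding x q by (simp only: R.scale_left_distrib R.scale_right_diff_distrib R.scale_scale)
            (simp add: algebra_simps)
        moreover have "pscale r (?D q) + x \<in> R.span (?D ` (P - {p}))"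
          by (intro R.span_add R.span_scale R.span_base x(1) imageI) (use q False in blast)
        ultimately show ?thesis by blast
      qed
    qed
    then obtain x r where x: "x \<in> R.span (?D ` (P - {p}))" "f = x + pscale r (D p)" by blast
    have "R.span (?D ` (P - {p})) \<subseteq> free_mod (J - {j})"
      using clear_free[OF D_free] by (intro R.span_minimal subspace_free_mod) blast
    then have "x j = 0" "f j = 0" using x(1) f unfolding free_mod_def by blast+
    then have "r * cst c = 0" using x(2) Dpj by (simp add: pscale_apply)
    then have "r * (cst c * cst (1 / c)) = 0" by (simp only: mult.assoc[symmetric] mult_zero_left)
    then have "r = 0" using c by (simp add: cst_def mult_single)
    then show "f \<in> R.span (?D ` (P - {p}))"
      using x by (simp only: R.scale_zero_left add_0_right)
  qed
  moreover have "\<exists>f'\<in>free_mod (J - {j}). f - f' \<in> K" if "f \<in> free_mod J\<^sub>0" for f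
  proof -
    obtain f' where f': "f' \<in> free_mod J" "f - f' \<in> K" using surj \<open>f \<in> free_mod J\<^sub>0\<close> by blast
    let ?f = "f' - pscale (cst (1 / c) * f' j) (D p)"
    have "f - ?f = (f - f') + pscale (cst (1 / c) * f' j) (D p)" by simp
    then have "f - ?f \<in> K" using R.subspace_add[OF K f'(2) clear_K] by metis
    then show ?thesis using clear_free[OF f'(1)] by blast
  qed
  ultimately show ?thesis
    unfolding S' presents_def using JJ\<^sub>0 by (simp only: prod.case) blast
qed

lemma prune_steps_presents:
  assumes "prune_step\<^sup>*\<^sup>* S S'" and "presents B J\<^sub>0 K S" and "R.subspace K"
  shows "presents B J\<^sub>0 K S'"
  using assms(1,2) by (induction rule: rtranclp_induct) (auto intro: prune_step_presents assms(3))

interpretation P: module "(*) :: ('v, 'k::field) mpoly \<Rightarrow> ('v, 'k) mpoly \<Rightarrow> ('v, 'k) mpoly"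
  by standard (auto simp: algebra_simps)

lemma single_in_max_ideal:
  assumes "a \<noteq> 0"
  shows "single a c \<in> max_ideal"
proof -
  obtain k where k: "lookup a k \<noteq> 0" using assms by (metis poly_mapping_eqI lookup_zero)
  then have "mon_dvd (single k 1) a" by (auto simp: mon_dvd_iff lookup_single when_def)
  then have "single a c = single (a - single k 1) c * X k"
    by (simp add: X_def mult_single mon_diff_add)
  then show ?thesis
    unfolding max_ideal_def by (metis P.span_base P.span_scale rangeI)
qed

text \<open>A homogeneous entry is \<open>c X\<^sup>a\<close>. If \<open>a = 0\<close> it is constant, hence zero after pruning; otherwise
  some variable divides it.\<close>

lemma pruned_in_max_ideal_multiple:
  fixes K :: "('v, 'k::field) vec set"
  assumes "presents B J\<^sub>0 K (J, P, D)" and "pruned (J, P, D)" and "finite J"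
  shows "free_mod J \<inter> K \<subseteq> R.span {pscale p f | p f. p \<in> max_ideal \<and> f \<in> free_mod J}"
    (is "_ \<subseteq> ?mF")
proof -
  have "D q \<in> ?mF" if q: "q \<in> P" for q
  proof -
    obtain m where free: "D q \<in> free_mod J" and m: "homogeneous B m (D q)"
      using assms(1) q unfolding presents_def by auto
    have entry: "D q j \<in> max_ideal" if j: "j \<in> J" for j
    proof (cases "m - B j = 0 \<or> D q j = 0")
      case True
      have "D q j = cst (lookup (D q j) 0) \<or> D q j = 0"
        using True homogeneous_entry[OF m, of j] unfolding cst_def by (auto split: if_splits)
      then have "D q j = 0"
        using assms(2) q j unfolding pruned_def cst_def by (auto) (metis Poly_Mapping.single_zero)
      then show ?thesis using P.span_zero unfolding max_ideal_def by simp
    next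
      case False
      then show ?thesis
        using homogeneous_entry[OF m, of j] single_in_max_ideal by metis
    qed
    have "D q = (\<Sum>j\<in>J. pscale (D q j) (\<lambda>i. if i = j then 1 else 0))"
    proof
      fix i
      have "(\<Sum>j\<in>J. D q j * (if i = j then 1 else 0)) = (if i \<in> J then D q i else 0)"
        using \<open>finite J\<close> by (simp add: if_distrib cong: if_cong)
      then show "D q i = (\<Sum>j\<in>J. pscale (D q j) (\<lambda>i. if i = j then 1 else 0)) i"
        using free by (simp add: sum_fun_apply pscale_apply free_mod_def)
    qed
    moreover have "(\<Sum>j\<in>J. pscale (D q j) (\<lambda>i. if i = j then 1 else 0)) \<in> ?mF"
    proof (rule R.span_sum)
      fix j assume j: "j \<in> J"
      then have "(\<lambda>i. if i = j then 1 else 0 :: ('v, 'k) mpoly) \<in> free_mod J" by (auto simp: free_mod_def)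
      then show "pscale (D q j) (\<lambda>i. if i = j then 1 else 0) \<in> ?mF"
        using entry[OF j] by (intro R.span_base) blast
    qed
    ultimately show ?thesis by (rule ssubst[where P = "\<lambda>x. x \<in> ?mF"])
  qed
  then have "R.span (D ` P) \<subseteq> ?mF"
    by (intro R.span_minimal R.subspace_span) blast
  then show ?thesis using assms(1) unfolding presents_def by auto
qed


section \<open>Generator-minimal presentations\<close>

lemma image_degrees_subset_support:
  assumes "fc_presentation s \<alpha> J \<beta> A sc M Mg"
    and "phi_image s \<alpha> J \<beta> A \<inter> cofree_comp s \<alpha> \<gamma> \<noteq> {0}"
  shows "\<gamma> \<in> graded_support Mg"
proof -
  let ?I = "phi_image s \<alpha> J \<beta> A"
  obtain \<psi> where bij: "bij_betw \<psi> ?I M" and add: "\<forall>x\<in>?I. \<forall>y\<in>?I. \<psi> (x + y) = \<psi> x + \<psi> y"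
    and deg: "\<psi> ` (?I \<inter> cofree_comp s \<alpha> \<gamma>) = Mg \<gamma>"
    using assms(1) unfolding fc_presentation_def graded_isomorphic_def by (elim conjE exE) simp
  have "phi s \<alpha> J \<beta> A 0 = 0"
    by (intro ext poly_mapping_eqI) (auto simp: lookup_phi intro!: sum.neutral)
  moreover have "0 \<in> free_mod J" by (simp add: free_mod_def)
  ultimately have 0: "0 \<in> ?I" unfolding phi_image_def by (metis imageI)
  then have "\<psi> (0 + 0) = \<psi> 0 + \<psi> 0" using add by blast
  then have \<psi>0: "\<psi> 0 = 0" by simp
  have "0 \<in> cofree_comp s \<alpha> \<gamma>" by (simp add: cofree_comp_def)
  then obtain x where x: "x \<in> ?I" "x \<in> cofree_comp s \<alpha> \<gamma>" "x \<noteq> 0"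
    using assms(2) 0 by blast
  have "\<psi> x \<noteq> 0"
    using bij_betw_imp_inj_on[OF bij] x 0 \<psi>0 by (metis inj_onD)
  moreover have "\<psi> x \<in> Mg \<gamma>" using x deg by blast
  ultimately show ?thesis unfolding graded_support_def by blast
qed

lemma phi_subset:
  assumes "finite J" "J' \<subseteq> J" "f \<in> free_mod J'"
  shows "phi s \<alpha> J' \<beta> A f = phi s \<alpha> J \<beta> A f"
proof (intro ext poly_mapping_eqI)
  fix i x
  show "lookup (phi s \<alpha> J' \<beta> A f i) x = lookup (phi s \<alpha> J \<beta> A f i) x"
    using assms by (auto simp: lookup_phi free_mod_def intro!: sum.mono_neutral_left)
qed

text \<open>Before the first step no generator has been removed, so \<open>f' = f\<close> serves as representative, and
  the columns generate the syzygies by Schreyer's theorem.\<close>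

lemma (in groebner_columns) presents_schreyer:
  assumes "schreyer_matrix ord s J g D"
  shows "presents source_deg J syzygies (J, spairs ord s J g, D)"
proof -
  have "D q \<in> free_mod J \<inter> syzygies \<and> (\<exists>m. homogeneous source_deg m (D q))"
    if "q \<in> spairs ord s J g" for q
    using schreyer_column(1-3)[OF assms, of "fst q" "snd q"] that by auto
  moreover have "\<exists>f'\<in>free_mod J. f - f' \<in> syzygies" if "f \<in> free_mod J" for f
    using that R.subspace_0[OF subspace_syzygies] by (metis diff_self)
  ultimately show ?thesis
    unfolding presents_def using schreyer[OF assms] by (simp only: prod.case) blast
qed

theorem proposition5p6:
  fixes sc :: "('v::finite, 'k::field) mpoly \<Rightarrow> 'm \<Rightarrow> 'm::ab_group_add"
    and M :: "'m set" and Mg :: "'v deg \<Rightarrow> 'm set"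
    and s t :: nat and \<alpha> \<beta> :: "nat \<Rightarrow> 'v deg" and A :: "nat \<Rightarrow> nat \<Rightarrow> 'k"
    and \<delta> :: "'v deg"
    and ord :: "nat \<times> 'v mon \<Rightarrow> nat \<times> 'v mon \<Rightarrow> bool"
  assumes "graded_module sc M Mg" and "fin_gen sc M"
    and "finite (graded_support Mg)"
    and "\<And>\<gamma>. \<gamma> \<in> graded_support Mg \<Longrightarrow> \<delta> \<le> \<gamma>"
    and "fc_presentation s \<alpha> {..<t} \<beta> A sc M Mg"
    and "pot_order s ord"
  shows
    "(\<exists>J \<beta>' A'. groebner_completion ord \<delta> s \<alpha> t \<beta> A J \<beta>' A') \<and>
     (\<forall>J \<beta>' A' g. groebner_completion ord \<delta> s \<alpha> t \<beta> A J \<beta>' A' \<longrightarrow>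
        g = gen s (\<lambda>i. \<alpha> i - \<delta>) (\<lambda>j. \<beta>' j - \<delta>) A' \<longrightarrow>
        (\<exists>D. schreyer_matrix ord s J g D) \<and>
        (\<forall>D. schreyer_matrix ord s J g D \<longrightarrow>
           \<not> (\<exists>S. S 0 = (J, spairs ord s J g, D) \<and> (\<forall>i::nat. prune_step (S i) (S (Suc i)))) \<and>
           (\<forall>J' P' D'. prune_step\<^sup>*\<^sup>* (J, spairs ord s J g, D) (J', P', D') \<and>
                pruned (J', P', D') \<longrightarrow>
              fc_presentation s \<alpha> J' \<beta>' A' sc M Mg \<and> generator_minimal s \<alpha> J' \<beta>' A')))"
proof -
  have support: "\<gamma> \<in> graded_support Mg"
    if "phi_image s \<alpha> {..<t} \<beta> A \<inter> cofree_comp s \<alpha> \<gamma> \<noteq> {0}" for \<gamma>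
    using assms(5) that by (rule image_degrees_subset_support)
  obtain rk lt where "position_order s ord rk lt"
    using pot_order_rank[OF assms(6)] by blast
  then interpret position_order s ord rk lt .
  have "\<exists>J \<beta>' A'. groebner_completion ord \<delta> s \<alpha> t \<beta> A J \<beta>' A'"
  proof (rule groebner_completion_exists)
    show "fc_matrix s \<alpha> {..<t} \<beta> A" using assms(5) by (simp add: fc_presentation_def)
    show "finite {\<gamma>. phi_image s \<alpha> {..<t} \<beta> A \<inter> cofree_comp s \<alpha> \<gamma> \<noteq> {0}}"
      by (rule finite_subset[OF _ assms(3)]) (use support in blast)
    show "\<delta> \<le> \<gamma>" if "phi_image s \<alpha> {..<t} \<beta> A \<inter> cofree_comp s \<alpha> \<gamma> \<noteq> {0}" for \<gamma>
      using that by (intro assms(4) support)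
  qed
  moreover have "(\<exists>D. schreyer_matrix ord s J g D) \<and>
        (\<forall>D. schreyer_matrix ord s J g D \<longrightarrow>
           \<not> (\<exists>S. S 0 = (J, spairs ord s J g, D) \<and> (\<forall>i::nat. prune_step (S i) (S (Suc i)))) \<and>
           (\<forall>J' P' D'. prune_step\<^sup>*\<^sup>* (J, spairs ord s J g, D) (J', P', D') \<and>
                pruned (J', P', D') \<longrightarrow>
              fc_presentation s \<alpha> J' \<beta>' A' sc M Mg \<and> generator_minimal s \<alpha> J' \<beta>' A'))"
    if completion: "groebner_completion ord \<delta> s \<alpha> t \<beta> A J \<beta>' A'"
      and g: "g = gen s (\<lambda>i. \<alpha> i - \<delta>) (\<lambda>j. \<beta>' j - \<delta>) A'" for J \<beta>' A' g
  proof -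
    let ?\<alpha> = "\<lambda>i. \<alpha> i - \<delta>" and ?\<beta> = "\<lambda>j. \<beta>' j - \<delta>"
    have fc: "fc_matrix s \<alpha> J \<beta>' A'"
      and image: "phi_image s \<alpha> J \<beta>' A' = phi_image s \<alpha> {..<t} \<beta> A"
      and groebner: "groebner_form ord s ?\<alpha> J ?\<beta> A'"
      using completion unfolding groebner_completion_def by blast+
    have fin: "finite J" using fc by (simp add: fc_matrix_def)
    have \<delta>: "\<delta> \<le> \<beta>' j" if "i < s" "j \<in> J" "A' i j \<noteq> 0" for i j
      using column_degree_in_image[OF fc that] unfolding image by (intro assms(4) support)
    interpret groebner_columns s ord rk lt ?\<alpha> J ?\<beta> A'
      using fin groebner by unfold_locales
    have kernel: "f \<in> syzygies \<longleftrightarrow> phi s \<alpha> J \<beta>' A' f = 0" for f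
    proof -
      have "phi s \<alpha> J \<beta>' A' f = cofree_embedding s ?\<alpha> (column_sum s ?\<beta> A' J f)"
        by (rule phi_eq_cofree_embedding[OF fc]) (rule \<delta>)
      then show ?thesis
        unfolding syzygies_def by (simp add: cofree_embedding_eq_0_iff column_sum_bounded)
    qed
    have phi_diff: "phi s \<alpha> J \<beta>' A' (f - f') = phi s \<alpha> J \<beta>' A' f - phi s \<alpha> J \<beta>' A' f'" for f f'
    proof -
      have "phi s \<alpha> J \<beta>' A' f = cofree_embedding s ?\<alpha> (column_sum s ?\<beta> A' J f)" for f
        by (rule phi_eq_cofree_embedding[OF fc]) (rule \<delta>)
      then show ?thesis by (simp only: column_sum_diff cofree_embedding_diff)
    qed
    have "\<exists>D. schreyer_matrix ord s J g D"
      unfolding g by (rule schreyer_matrix_exists)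
    moreover have "\<not> (\<exists>S. S 0 = (J, spairs ord s J g, D) \<and> (\<forall>i::nat. prune_step (S i) (S (Suc i))))" for D
      \<comment> \<open>every step removes a row\<close>
      using prune_terminates fin by (metis fst_conv)
    moreover have "fc_presentation s \<alpha> J' \<beta>' A' sc M Mg \<and> generator_minimal s \<alpha> J' \<beta>' A'"
      if D: "schreyer_matrix ord s J g D"
        and steps: "prune_step\<^sup>*\<^sup>* (J, spairs ord s J g, D) (J', P', D')"
        and pruned: "pruned (J', P', D')" for D J' P' D'
    proof
      have pres: "presents (\<lambda>j. mon_of (?\<beta> j)) J syzygies (J', P', D')"
        using prune_steps_presents[OF steps _ subspace_syzygies] presents_schreyer D unfolding g by blast
      have J': "J' \<subseteq> J" and surj: "\<And>f. f \<in> free_mod J \<Longrightarrow> \<exists>f'\<in>free_mod J'. f - f' \<in> syzygies"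
        using pres unfolding presents_def by auto
      have phi_eq: "phi s \<alpha> J' \<beta>' A' f = phi s \<alpha> J \<beta>' A' f" if "f \<in> free_mod J'" for f
        by (rule phi_subset[OF fin J' that])
      have "phi_image s \<alpha> J' \<beta>' A' = phi_image s \<alpha> J \<beta>' A'"
      proof (intro equalityI subsetI)
        fix x assume "x \<in> phi_image s \<alpha> J' \<beta>' A'"
        then obtain f where "f \<in> free_mod J'" "x = phi s \<alpha> J \<beta>' A' f"
          unfolding phi_image_def using phi_eq by auto
        then show "x \<in> phi_image s \<alpha> J \<beta>' A'"
          unfolding phi_image_def using J' by (auto simp: free_mod_def)
      next
        fix x assume "x \<in> phi_image s \<alpha> J \<beta>' A'"
        then obtain f where f: "f \<in> free_mod J" "x = phi s \<alpha> J \<beta>' A' f"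
          unfolding phi_image_def by blast
        then obtain f' where f': "f' \<in> free_mod J'" "f - f' \<in> syzygies" using surj by blast
        then have "x = phi s \<alpha> J \<beta>' A' f'"
          using f(2) unfolding kernel phi_diff by (simp only: right_minus_eq)
        then show "x \<in> phi_image s \<alpha> J' \<beta>' A'"
          unfolding phi_image_def using f'(1) phi_eq by (metis imageI)
      qed
      moreover have "fc_matrix s \<alpha> J' \<beta>' A'"
        using fc J' unfolding fc_matrix_def by (auto intro: finite_subset)
      ultimately show "fc_presentation s \<alpha> J' \<beta>' A' sc M Mg"
        using assms(5) unfolding fc_presentation_def image by (simp only:)
      have "{f \<in> free_mod J'. phi s \<alpha> J' \<beta>' A' f = 0} \<subseteq> free_mod J' \<inter> syzygies"
        using phi_eq kernel by auto
      also have "\<dots> \<subseteq> R.span {pscale p f | p f. p \<in> max_ideal \<and> f \<in> free_mod J'}"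
        by (rule pruned_in_max_ideal_multiple[OF pres pruned finite_subset[OF J' fin]])
      finally show "generator_minimal s \<alpha> J' \<beta>' A'" unfolding generator_minimal_def .
    qed
    ultimately show ?thesis by blast
  qed
  ultimately show ?thesis by blast
qed

end
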